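(* Let $E$ be a separable Banach space and let $\tau^*$ be the Mackey topology $\tau(L_\infty(\Omega,E^*_{\sigma^*}),L_1(\Omega,E))$ on $L_\infty(\Omega,E^*_{\sigma^*})$. Let $(f_n)_n$ be a sequence of extended real-valued $\mathbb{T}\otimes\mathcal{B}(E^*_{\sigma^*})$-measurable integrands defined on $\Omega\times E^*$ such that there exist $x_0^*\in L_\infty(\Omega,E^*_{\sigma^*})$ and $u_0\in L_1(\Omega,\mathbb{R})$ with $f_n(x_0^* )\le u_0$ for every $n$. Then, with $f=\|\cdot\|_*\text{-}ls_e f_n$, $$\tau^*\text{-}ls_e\, I_{f_n}\ \le\ I_f\qquad\text{on } L_\infty(\Omega,E^*_{\sigma^*}).$$
   Context: $(\Omega,\mathbb{T},\mu)$ is a measure space with $\mu$ a $\sigma$-finite positive measure and $\mathbb{T}$ $\mu$-complete. $E^*_{\sigma^*}$ is $E^*$ with the weak star topology $\sigma(E^*,E)$ and $\mathcal{B}(E^*_{\sigma^*})$ its Borel $\sigma$-algebra; $\|\cdot\|_*$ is the dual norm. $L_\infty(\Omega,E^*_{\sigma^*})$ is the space of classes (a.e. equality) of scalarly measurable functions $x^*:\Omega\to E^*$ with $\|x^*\|_*\in L_\infty(\Omega,\mathbb{R})$; it is the dual of $L_1(\Omega,E)$ via $\langle x^*,x\rangle=\int_\Omega\langle x^*(\omega),x(\omega)\rangle\,d\mu$. $\tau^*$ is the topology of uniform convergence on the $\sigma(L_1(\Omega,E),L_\infty(\Omega,E^*_{\sigma^*}))$-compact convex subsets of $L_1(\Omega,E)$.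 For an integrand $g$ on $\Omega\times E^*$, $g(x^* )$ is the function $\omega\mapsto g(\omega,x^*(\omega))$, and $I_g(x^* )=\int^*_\Omega g(x^* )\,d\mu$, where $\int^*_\Omega v\,d\mu=\inf\{\int_\Omega u\,d\mu: u\in L_1(\Omega,\mathbb{R}),\ u\ge v\text{ a.e.}\}$. Inequalities between functions on $\Omega$ hold a.e. For functions $g_n$ on a topological space $(Y,\mathcal{T})$, the upper epi-limit is $(\mathcal{T}\text{-}ls_e g_n)(y)=\sup_{V\in\mathcal{N}(y)}\limsup_n\inf_{y'\in V}g_n(y')$, with $\mathcal{N}(y)$ the open neighbourhoods of $y$. The integrand $f$ is defined pointwise: $f(\omega,\cdot)=\|\cdot\|_*\text{-}ls_e f_n(\omega,\cdot)$. *)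

theory Defs
  imports "HOL-Analysis.Analysis"
begin

text \<open>The dual \<open>E*\<close> is the type \<open>'e \<Rightarrow>\<^sub>L real\<close>, whose norm is the dual norm. For scalar-valued
  operators the strong operator topology of the library is the topology of pointwise convergence
  on \<open>E\<close>, i.e. the weak star topology.\<close>

abbreviation weak_star_topology :: "('e::real_normed_vector \<Rightarrow>\<^sub>L real) topology" where
  "weak_star_topology \<equiv> strong_operator_topology"

definition weak_star_borel :: "('e::real_normed_vector \<Rightarrow>\<^sub>L real) measure" where
  "weak_star_borel = sigma UNIV {U. openin weak_star_topology U}"

text \<open>Elements of the spaces are represented by functions, not by classes modulo a.e. equality.
  The topologies below only see functions through integrals, so they are the inverse images of the
  topologies on the quotient spaces: open sets are saturated for a.e. equality.\<close>

definition L1_space :: "'a measure \<Rightarrow> ('a \<Rightarrow> 'e::{banach, second_countable_topology}) set" where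
  "L1_space M = {x. integrable M x}"

definition scalarly_measurable ::
    "'a measure \<Rightarrow> ('a \<Rightarrow> ('e::real_normed_vector \<Rightarrow>\<^sub>L real)) \<Rightarrow> bool" where
  "scalarly_measurable M xs \<longleftrightarrow> (\<forall>e. (\<lambda>\<omega>. blinfun_apply (xs \<omega>) e) \<in> borel_measurable M)"

definition Linf_dual_space ::
    "'a measure \<Rightarrow> ('a \<Rightarrow> ('e::real_normed_vector \<Rightarrow>\<^sub>L real)) set" where
  "Linf_dual_space M = {xs. scalarly_measurable M xs \<and>
     (\<lambda>\<omega>. norm (xs \<omega>)) \<in> borel_measurable M \<and> (\<exists>C. AE \<omega> in M. norm (xs \<omega>) \<le> C)}"

definition pairing ::
    "'a measure \<Rightarrow> ('a \<Rightarrow> ('e::real_normed_vector \<Rightarrow>\<^sub>L real)) \<Rightarrow> ('a \<Rightarrow> 'e) \<Rightarrow> real" where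
  "pairing M xs x = (\<integral>\<omega>. blinfun_apply (xs \<omega>) (x \<omega>) \<partial>M)"

text \<open>The weak topology is the initial topology for the family of all functionals
  \<open>pairing M xs\<close>.\<close>

definition weak_L1_topology ::
    "'a measure \<Rightarrow> ('a \<Rightarrow> 'e::{banach, second_countable_topology}) topology" where
  "weak_L1_topology M =
     pullback_topology (L1_space M) (\<lambda>x. \<lambda>xs\<in>Linf_dual_space M. pairing M xs x)
       (product_topology (\<lambda>_. euclideanreal) (Linf_dual_space M))"

text \<open>Convexity is spelt out because functions do not form a \<open>real_vector\<close> type.\<close>

definition fun_convex :: "('a \<Rightarrow> 'e::real_vector) set \<Rightarrow> bool" where
  "fun_convex K \<longleftrightarrow> (\<forall>x\<in>K. \<forall>y\<in>K. \<forall>t\<in>{0..1}. (\<lambda>\<omega>. (1 - t) *\<^sub>R x \<omega> + t *\<^sub>R y \<omega>) \<in> K)"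

text \<open>A set is open if around each of its points \<open>y\<close> it contains a basic neighbourhood, given by
  finitely many members of \<open>\<S>\<close> and a tolerance \<open>\<epsilon>\<close>.\<close>

definition uniform_conv_topology ::
    "'y set \<Rightarrow> ('y \<Rightarrow> 'x \<Rightarrow> real) \<Rightarrow> 'x set set \<Rightarrow> 'y topology" where
  "uniform_conv_topology Y b \<S> = topology (\<lambda>U. U \<subseteq> Y \<and>
     (\<forall>y\<in>U. \<exists>\<K> \<epsilon>. finite \<K> \<and> \<K> \<subseteq> \<S> \<and> \<epsilon> > 0 \<and>
        {z \<in> Y. \<forall>K\<in>\<K>. \<forall>x\<in>K. \<bar>b z x - b y x\<bar> < \<epsilon>} \<subseteq> U))"

lemma openin_uniform_conv_topology:
  "openin (uniform_conv_topology Y b \<S>) U \<longleftrightarrow> U \<subseteq> Y \<and>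
     (\<forall>y\<in>U. \<exists>\<K> \<epsilon>. finite \<K> \<and> \<K> \<subseteq> \<S> \<and> \<epsilon> > 0 \<and>
        {z \<in> Y. \<forall>K\<in>\<K>. \<forall>x\<in>K. \<bar>b z x - b y x\<bar> < \<epsilon>} \<subseteq> U)"
proof -
  define N where "N = (\<lambda>y \<K> \<epsilon>. {z \<in> Y. \<forall>K\<in>\<K>. \<forall>x\<in>K. \<bar>b z x - b y x\<bar> < (\<epsilon>::real)})"
  define P where "P = (\<lambda>U. U \<subseteq> Y \<and>
     (\<forall>y\<in>U. \<exists>\<K> \<epsilon>. finite \<K> \<and> \<K> \<subseteq> \<S> \<and> \<epsilon> > 0 \<and> N y \<K> \<epsilon> \<subseteq> U))"
  have inter: "P (S \<inter> T)" if S: "P S" and T: "P T" for S T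
    unfolding P_def
  proof (intro conjI ballI)
    show "S \<inter> T \<subseteq> Y" using S by (auto simp: P_def)
    fix y assume "y \<in> S \<inter> T"
    then obtain \<K>1 \<epsilon>1 \<K>2 \<epsilon>2 where
      *: "finite \<K>1" "\<K>1 \<subseteq> \<S>" "\<epsilon>1 > 0" "N y \<K>1 \<epsilon>1 \<subseteq> S"
         "finite \<K>2" "\<K>2 \<subseteq> \<S>" "\<epsilon>2 > 0" "N y \<K>2 \<epsilon>2 \<subseteq> T"
      using S T unfolding P_def by (metis IntD1 IntD2)
    have "N y (\<K>1 \<union> \<K>2) (min \<epsilon>1 \<epsilon>2) \<subseteq> N y \<K>1 \<epsilon>1 \<inter> N y \<K>2 \<epsilon>2"
      by (auto simp: N_def)
    then have "N y (\<K>1 \<union> \<K>2) (min \<epsilon>1 \<epsilon>2) \<subseteq> S \<inter> T" using * by blast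
    then show "\<exists>\<K> \<epsilon>. finite \<K> \<and> \<K> \<subseteq> \<S> \<and> \<epsilon> > 0 \<and> N y \<K> \<epsilon> \<subseteq> S \<inter> T"
      using * by (intro exI[of _ "\<K>1 \<union> \<K>2"] exI[of _ "min \<epsilon>1 \<epsilon>2"]) auto
  qed
  have union: "P (\<Union>\<U>)" if U: "\<forall>S\<in>\<U>. P S" for \<U>
    unfolding P_def
  proof (intro conjI ballI)
    show "\<Union>\<U> \<subseteq> Y" using U by (auto simp: P_def)
    fix y assume "y \<in> \<Union>\<U>"
    then obtain S where S: "S \<in> \<U>" "y \<in> S" by blast
    then obtain \<K> \<epsilon> where "finite \<K>" "\<K> \<subseteq> \<S>" "\<epsilon> > 0" "N y \<K> \<epsilon> \<subseteq> S"
      using U unfolding P_def by meson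
    then show "\<exists>\<K> \<epsilon>. finite \<K> \<and> \<K> \<subseteq> \<S> \<and> \<epsilon> > 0 \<and> N y \<K> \<epsilon> \<subseteq> \<Union>\<U>"
      using S(1) by blast
  qed
  have "istopology P" unfolding istopology_def using inter union by blast
  then show ?thesis
    unfolding uniform_conv_topology_def P_def N_def by (simp add: topology_inverse')
qed

text \<open>Requiring the sets \<open>K\<close> to be balanced as well would not change this topology, as the convex
  hull of \<open>K \<union> -K\<close> is again weakly compact.\<close>

definition mackey_topology ::
    "'a measure \<Rightarrow> ('a \<Rightarrow> ('e::{banach, second_countable_topology} \<Rightarrow>\<^sub>L real)) topology" where
  "mackey_topology M = uniform_conv_topology (Linf_dual_space M) (pairing M)
     {K. compactin (weak_L1_topology M) K \<and> fun_convex K}"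

text \<open>The infimum of the empty set is \<open>\<infinity>\<close>.\<close>

definition upper_integral :: "'a measure \<Rightarrow> ('a \<Rightarrow> ereal) \<Rightarrow> ereal" where
  "upper_integral M v =
     (INF u\<in>{u :: 'a \<Rightarrow> real. integrable M u \<and> (AE \<omega> in M. v \<omega> \<le> ereal (u \<omega>))}.
        ereal (\<integral>\<omega>. u \<omega> \<partial>M))"

definition integral_functional ::
    "'a measure \<Rightarrow> ('a \<Rightarrow> 'y \<Rightarrow> ereal) \<Rightarrow> ('a \<Rightarrow> 'y) \<Rightarrow> ereal" where
  "integral_functional M g x = upper_integral M (\<lambda>\<omega>. g \<omega> (x \<omega>))"

definition epi_limsup :: "'y topology \<Rightarrow> (nat \<Rightarrow> 'y \<Rightarrow> ereal) \<Rightarrow> 'y \<Rightarrow> ereal" where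
  "epi_limsup T g y =
     (SUP V\<in>{V. openin T V \<and> y \<in> V}. limsup (\<lambda>n. INF y'\<in>V. g n y'))"

end

theory Submission
  imports Defs
begin

text \<open>Fix \<open>x\<close> in \<open>L\<^sub>\<infinity>(\<Omega>, E*)\<close>, a Mackey-open set \<open>V\<close> containing \<open>x\<close>, and an integrable \<open>u\<close> with
\<open>f(\<omega>, x(\<omega>)) \<le> u(\<omega>)\<close> almost everywhere. Enlarging \<open>u\<close> slightly to an integrable \<open>v > u\<close>, the
definition of the upper epi-limit says: for every \<open>\<delta> > 0\<close> and almost every \<open>\<omega>\<close>, for all large \<open>n\<close>
there is some \<open>y\<close> with \<open>\<parallel>y - x(\<omega>)\<parallel> < \<delta>\<close> and \<open>f\<^sub>n(\<omega>, y) < v(\<omega>)\<close>. Choose such a \<open>y = y\<^sub>n(\<omega>)\<close>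
measurably on the set \<open>W\<^sub>n\<close> of those \<open>\<omega>\<close> for which it exists, and let \<open>z\<^sub>n\<close> be \<open>y\<^sub>n\<close> on \<open>W\<^sub>n\<close> and
\<open>x\<^sub>0\<close> elsewhere. Almost every \<open>\<omega>\<close> lies in \<open>W\<^sub>n\<close> for all large \<open>n\<close>, so dominated convergence bounds
the limit superior of \<open>I(f\<^sub>n)(z\<^sub>n)\<close> by the integral of \<open>v\<close>. It remains to see that \<open>z\<^sub>n \<in> V\<close> eventually.
Two facts carry the argument.

The first is a measurable selection theorem for sets in the product of a \<open>\<sigma>\<close>-finite measure space
with the weak star Borel sets of \<open>E*\<close> (\<open>measurable_selection_dual\<close>). The dual is a measurable image of
the Baire space: a functional is coded by approximations to its values on a dense sequence. A
measurable subset of \<open>\<Omega>\<close> times the Baire space is a Suslin set over measurable rectangles; as in the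
proof of Choquet's capacitability theorem, the branches may be restricted to a compact set of
sequences at the cost of arbitrarily little outer measure, and on a compact set of branches the
leftmost one depends measurably on \<open>\<omega>\<close>.

The second is that a sequence in \<open>L\<^sub>\<infinity>(\<Omega>, E*)\<close> that is bounded and converges to \<open>0\<close> in norm almost
everywhere is uniformly small on each weakly compact subset of \<open>L\<^sub>1(\<Omega>, E)\<close>
(\<open>pairing_tendsto_0_uniformly\<close>). If it were not, one could pass to pieces \<open>\<xi>\<^sub>k\<close> with
\<open>\<Sum>\<^sub>k \<parallel>\<xi>\<^sub>k(\<omega>)\<parallel>\<close> bounded and pairings \<open>\<langle>\<xi>\<^sub>k, h\<^sub>k\<rangle>\<close> bounded away from \<open>0\<close>, with all \<open>h\<^sub>k\<close> in a weakly compact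
set. The map \<open>h \<mapsto> (\<langle>\<xi>\<^sub>k, h\<rangle>)\<^sub>k\<close> then carries weak convergence to weak convergence in \<open>\<ell>\<^sub>1\<close>, and the
gliding hump of Schur's theorem gives a contradiction. Applied to \<open>z\<^sub>n - x\<close>, cut into its part on
\<open>W\<^sub>n\<close> (of norm at most \<open>\<delta>\<close>) and its part off \<open>W\<^sub>n\<close> (which tends to \<open>0\<close>), this puts \<open>z\<^sub>n\<close> in \<open>V\<close>.\<close>

section \<open>Measurability of functions with values in the dual\<close>

lemma dense_sequence_exists:
  obtains d :: "nat \<Rightarrow> 'e::{metric_space, second_countable_topology}"
  where "closure (range d) = UNIV"
proof -
  obtain D :: "'e set" where D: "countable D" "\<And>X. open X \<Longrightarrow> X \<noteq> {} \<Longrightarrow> \<exists>y\<in>D. y \<in> X"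
    by (erule countable_dense_setE)
  have "D \<noteq> {}" using D(2)[of UNIV] by auto
  have "e \<in> closure D" for e
    unfolding closure_approachable
  proof (intro allI impI)
    fix \<epsilon> :: real assume "\<epsilon> > 0"
    then obtain y where "y \<in> D" "y \<in> ball e \<epsilon>"
      using D(2)[of "ball e \<epsilon>"] by auto
    then show "\<exists>y\<in>D. dist y e < \<epsilon>" by (auto simp: dist_commute)
  qed
  then have "closure (range (from_nat_into D)) = UNIV"
    using range_from_nat_into[OF \<open>D \<noteq> {}\<close> D(1)] by auto
  then show thesis by (rule that)
qed

lemma dense_sequence_tendsto:
  fixes d :: "nat \<Rightarrow> 'e::metric_space"
  assumes d: "closure (range d) = UNIV"
  obtains r where "(\<lambda>n. d (r n)) \<longlonglongrightarrow> e"
proof -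
  have "e \<in> closure (range d)" by (simp add: d)
  then obtain x where x: "\<And>n. x n \<in> range d" "x \<longlonglongrightarrow> e"
    unfolding closure_sequential by blast
  then have "\<forall>n. \<exists>i. x n = d i" by blast
  then obtain r where "\<forall>n. x n = d (r n)" by (rule choice[THEN exE])
  then have "x = (\<lambda>n. d (r n))" by auto
  with x(2) show thesis by (intro that[of r]) simp
qed

lemma scalarly_measurable_dense:
  fixes g :: "'a \<Rightarrow> ('e::real_normed_vector \<Rightarrow>\<^sub>L real)" and d :: "nat \<Rightarrow> 'e"
  assumes d: "closure (range d) = UNIV"
    and g: "\<And>i::nat. (\<lambda>\<omega>. g \<omega> (d i)) \<in> borel_measurable M"
  shows "scalarly_measurable M g"
  unfolding scalarly_measurable_def
proof
  fix e
  obtain r where r: "(\<lambda>n. d (r n)) \<longlonglongrightarrow> e" using dense_sequence_tendsto[OF d] by blast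
  show "(\<lambda>\<omega>. g \<omega> e) \<in> borel_measurable M"
    by (rule borel_measurable_LIMSEQ_real[where u = "\<lambda>n \<omega>. g \<omega> (d (r n))"])
       (auto intro!: g tendsto_intros r)
qed

text \<open>Only countably many vectors are needed to test the dual norm; this is what makes the norm of a
scalarly measurable function measurable.\<close>

lemma norm_blinfun_le_dense_iff:
  fixes y :: "'e::real_normed_vector \<Rightarrow>\<^sub>L real" and d :: "nat \<Rightarrow> 'e"
  assumes d: "closure (range d) = UNIV"
  shows "norm y \<le> c \<longleftrightarrow> 0 \<le> c \<and> (\<forall>i. \<bar>y (d i)\<bar> \<le> c * norm (d i))"
proof
  assume c: "norm y \<le> c"
  have "\<bar>y e\<bar> \<le> c * norm e" for e
    using order_trans[OF norm_blinfun[of y e] mult_right_mono[OF c norm_ge_zero]] by simp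
  then show "0 \<le> c \<and> (\<forall>i. \<bar>y (d i)\<bar> \<le> c * norm (d i))"
    using c order_trans[OF norm_ge_zero c] by blast
next
  assume c: "0 \<le> c \<and> (\<forall>i. \<bar>y (d i)\<bar> \<le> c * norm (d i))"
  have "norm (y e) \<le> c * norm e" for e
  proof -
    obtain r where r: "(\<lambda>n. d (r n)) \<longlonglongrightarrow> e" using dense_sequence_tendsto[OF d] by blast
    show ?thesis
      by (rule LIMSEQ_le[of "\<lambda>n. norm (y (d (r n)))" _ "\<lambda>n. c * norm (d (r n))"])
         (use c in \<open>auto intro!: tendsto_intros r\<close>)
  qed
  then show "norm y \<le> c" using c by (intro norm_blinfun_bound) auto
qed

lemma scalarly_measurable_norm:
  fixes g :: "'a \<Rightarrow> ('e::{real_normed_vector, second_countable_topology} \<Rightarrow>\<^sub>L real)"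
  assumes "scalarly_measurable M g"
  shows "(\<lambda>\<omega>. norm (g \<omega>)) \<in> borel_measurable M"
proof -
  obtain d :: "nat \<Rightarrow> 'e" where d: "closure (range d) = UNIV"
    using dense_sequence_exists by blast
  have *: "(\<lambda>\<omega>. g \<omega> e) \<in> borel_measurable M" for e
    using assms by (simp add: scalarly_measurable_def)
  have "{\<omega>\<in>space M. norm (g \<omega>) \<le> c} \<in> sets M" for c
  proof -
    have "{\<omega>\<in>space M. norm (g \<omega>) \<le> c}
      = {\<omega>\<in>space M. 0 \<le> c \<and> (\<forall>i. \<bar>g \<omega> (d i)\<bar> \<le> c * norm (d i))}"
      using norm_blinfun_le_dense_iff[OF d] by blast
    also have "\<dots> \<in> sets M"
      by (intro sets.sets_Collect_conj sets.sets_Collect_const sets.sets_Collect_countable_All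
          borel_measurable_le borel_measurable_abs borel_measurable_const *)
    finally show ?thesis .
  qed
  then show ?thesis unfolding borel_measurable_iff_le by blast
qed

lemma scalarly_measurable_diff:
  assumes "scalarly_measurable M g" "scalarly_measurable M h"
  shows "scalarly_measurable M (\<lambda>\<omega>. g \<omega> - h \<omega>)"
  using assms by (auto simp: scalarly_measurable_def blinfun.diff_left intro!: borel_measurable_diff)

lemma scalarly_measurable_scaleR:
  assumes "(c :: _ \<Rightarrow> real) \<in> borel_measurable M" "scalarly_measurable M g"
  shows "scalarly_measurable M (\<lambda>\<omega>. c \<omega> *\<^sub>R g \<omega>)"
  using assms by (auto simp: scalarly_measurable_def blinfun.scaleR_left intro!: borel_measurable_times)

lemma scalarly_measurable_If:
  assumes "Measurable.pred M P" "scalarly_measurable M g" "scalarly_measurable M h"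
  shows "scalarly_measurable M (\<lambda>\<omega>. if P \<omega> then g \<omega> else h \<omega>)"
proof -
  have "(\<lambda>\<omega>. (if P \<omega> then g \<omega> else h \<omega>) e) = (\<lambda>\<omega>. if P \<omega> then g \<omega> e else h \<omega> e)" for e
    by auto
  then show ?thesis
    using assms by (auto simp: scalarly_measurable_def intro!: measurable_If)
qed

text \<open>Approximate \<open>h\<close> pointwise by simple functions: for each of the finitely many values \<open>e\<close> of a simple
function, \<open>\<omega> \<mapsto> g \<omega> e\<close> is measurable by hypothesis.\<close>

lemma scalarly_measurable_pairing:
  fixes g :: "'a \<Rightarrow> ('e::{real_normed_vector, second_countable_topology} \<Rightarrow>\<^sub>L real)"
  assumes g: "scalarly_measurable M g" and h: "h \<in> borel_measurable M"
  shows "(\<lambda>\<omega>. g \<omega> (h \<omega>)) \<in> borel_measurable M"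
proof -
  obtain s where s: "\<And>i. simple_function M (s i)"
    and lim: "\<And>\<omega>. \<omega> \<in> space M \<Longrightarrow> (\<lambda>i. s i \<omega>) \<longlonglongrightarrow> h \<omega>"
    using borel_measurable_implies_sequence_metric[OF h, of 0] by blast
  show ?thesis
  proof (rule borel_measurable_LIMSEQ_real[where u = "\<lambda>i \<omega>. g \<omega> (s i \<omega>)"])
    fix i
    have "(\<lambda>\<omega>. (\<lambda>e \<omega>. g \<omega> e) (s i \<omega>) \<omega>) \<in> borel_measurable M"
    proof (rule measurable_compose_countable'[of "s i ` space M"])
      show "countable (s i ` space M)"
        using simple_functionD(1)[OF s[of i]] by (rule countable_finite)
      show "s i \<in> M \<rightarrow>\<^sub>M count_space (s i ` space M)"
        using s by (auto simp: measurable_def simple_function_def)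
          (metis (no_types, opaque_lifting) Int_commute s simple_functionD(2))
    qed (use g in \<open>simp add: scalarly_measurable_def\<close>)
    then show "(\<lambda>\<omega>. g \<omega> (s i \<omega>)) \<in> borel_measurable M" .
  qed (auto intro!: tendsto_intros lim)
qed

lemma blinfun_tendsto_bounded_dense:
  fixes z :: "nat \<Rightarrow> ('e::real_normed_vector \<Rightarrow>\<^sub>L real)" and y :: "'e \<Rightarrow>\<^sub>L real" and d :: "nat \<Rightarrow> 'e"
  assumes d: "closure (range d) = UNIV"
    and bd: "\<And>n. norm (z n) \<le> R" "norm y \<le> R"
    and lim: "\<And>i. (\<lambda>n. z n (d i)) \<longlonglongrightarrow> y (d i)"
  shows "(\<lambda>n. z n e) \<longlonglongrightarrow> y e"
proof (rule LIMSEQ_I)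
  fix \<epsilon> :: real assume "\<epsilon> > 0"
  have R: "R \<ge> 0" using order_trans[OF norm_ge_zero bd(2)] .
  have "\<epsilon> / (3 * (R + 1)) > 0" using \<open>\<epsilon> > 0\<close> R by simp
  moreover have "e \<in> closure (range d)" using d by simp
  ultimately obtain i where i: "dist (d i) e < \<epsilon> / (3 * (R + 1))"
    unfolding closure_approachable by blast
  have small: "\<bar>w (d i) - w e\<bar> < \<epsilon> / 3" if "norm w \<le> R" for w :: "'e \<Rightarrow>\<^sub>L real"
  proof -
    have "\<bar>w (d i) - w e\<bar> \<le> norm w * norm (d i - e)"
      using norm_blinfun[of w "d i - e"] by (simp add: blinfun.diff_right)
    also have "\<dots> \<le> (R + 1) * dist (d i) e"
      using that by (auto simp: dist_norm intro!: mult_right_mono)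
    also have "\<dots> < \<epsilon> / 3"
      using i R by (simp add: field_simps)
    finally show ?thesis .
  qed
  obtain N where N: "\<And>n. n \<ge> N \<Longrightarrow> \<bar>z n (d i) - y (d i)\<bar> < \<epsilon> / 3"
    using LIMSEQ_D[OF lim[of i], of "\<epsilon> / 3"] \<open>\<epsilon> > 0\<close> by auto
  have "norm (z n e - y e) < \<epsilon>" if "n \<ge> N" for n
    using N[OF that] small[OF bd(1)[of n]] small[OF bd(2)] by (auto simp: abs_if split: if_splits)
  then show "\<exists>N. \<forall>n\<ge>N. norm (z n e - y e) < \<epsilon>" by blast
qed

lemma limitin_weak_star:
  assumes "\<And>e. (\<lambda>n. blinfun_apply (z n) e) \<longlonglongrightarrow> blinfun_apply y e"
  shows "limitin weak_star_topology z y sequentially"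
proof -
  have "limitin (product_topology (\<lambda>i. euclidean) UNIV) (\<lambda>n. blinfun_apply (z n)) (blinfun_apply y) sequentially"
    using assms by (auto simp: limitin_componentwise)
  then have *: "limitin euclidean (\<lambda>n. blinfun_apply (z n)) (blinfun_apply y) sequentially"
    by (simp add: euclidean_product_topology)
  show ?thesis
    unfolding limitin_def
  proof (intro conjI allI impI)
    fix U assume "openin weak_star_topology U \<and> y \<in> U"
    then obtain V where V: "open V" "U = blinfun_apply -` V" "y \<in> U"
      unfolding strong_operator_topology_def by (auto simp: openin_pullback_topology)
    then show "\<forall>\<^sub>F n in sequentially. z n \<in> U"
      using * unfolding limitin_def by (auto)
  qed (simp add: strong_operator_topology_topspace)
qed

lemma space_weak_star_borel [simp]: "space weak_star_borel = UNIV"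
  by (simp add: weak_star_borel_def)

lemma scalarly_measurable_weak_star_borel_ident:
  "scalarly_measurable weak_star_borel (\<lambda>y. y)"
  unfolding scalarly_measurable_def
proof
  fix e :: 'a
  show "(\<lambda>y. blinfun_apply y e) \<in> borel_measurable weak_star_borel"
  proof (rule borel_measurableI)
    fix S :: "real set" assume "open S"
    then have "openin weak_star_topology ((\<lambda>y. blinfun_apply y e) -` S)"
      using strong_operator_topology_continuous_evaluation[of e]
      by (auto simp: continuous_map_alt strong_operator_topology_topspace)
    then show "(\<lambda>y. blinfun_apply y e) -` S \<inter> space weak_star_borel \<in> sets weak_star_borel"
      by (simp add: weak_star_borel_def)
  qed
qed

text \<open>The nontrivial direction says that the evaluations generate all weak star open sets as a
\<open>\<sigma>\<close>-algebra. On a norm ball, weak star convergence is convergence on a dense sequence, so the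
countably many sets \<open>B (R, l)\<close> below, which prescribe finitely many rounded values inside a ball,
form a network: every weak star open set is the union of those it contains.\<close>

lemma measurable_weak_star_borel_iff:
  fixes g :: "'a \<Rightarrow> ('e::{real_normed_vector, second_countable_topology} \<Rightarrow>\<^sub>L real)"
  shows "g \<in> M \<rightarrow>\<^sub>M weak_star_borel \<longleftrightarrow> scalarly_measurable M g"
proof
  assume "g \<in> M \<rightarrow>\<^sub>M weak_star_borel"
  then show "scalarly_measurable M g"
    using scalarly_measurable_weak_star_borel_ident
    by (auto simp: scalarly_measurable_def intro: measurable_compose)
next
  assume g: "scalarly_measurable M g"
  obtain d :: "nat \<Rightarrow> 'e" where d: "closure (range d) = UNIV"
    using dense_sequence_exists by blast
  have [measurable]: "(\<lambda>\<omega>. norm (g \<omega>)) \<in> borel_measurable M"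
    "(\<lambda>\<omega>. g \<omega> e) \<in> borel_measurable M" for e
    using g scalarly_measurable_norm by (auto simp: scalarly_measurable_def)
  define B where "B = (\<lambda>(R::nat, l::int list). {y :: 'e \<Rightarrow>\<^sub>L real. norm y \<le> real R \<and>
     (\<forall>i<length l. \<bar>real (length l) * blinfun_apply y (d i) - of_int (l ! i)\<bar> \<le> 1)})"
  have "g -` U \<inter> space M \<in> sets M" if U: "openin weak_star_topology U" for U
  proof -
    have key: "\<exists>p. y \<in> B p \<and> B p \<subseteq> U" if "y \<in> U" for y
    proof (rule ccontr)
      assume no: "\<nexists>p. y \<in> B p \<and> B p \<subseteq> U"
      \<comment> \<open>If no \<open>B (R, l n)\<close> containing \<open>y\<close> lies in \<open>U\<close>, points \<open>z n\<close> outside \<open>U\<close> converge weak star to \<open>y\<close>.\<close>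
      obtain R :: nat where R: "norm y \<le> real R" using real_arch_simple by blast
      define l where "l n = map (\<lambda>i. \<lfloor>real n * y (d i)\<rfloor>) [0..<n]" for n
      have "y \<in> B (R, l n)" for n
        unfolding B_def l_def using R by (auto, linarith)
      with no have "\<exists>z. z \<in> B (R, l n) \<and> z \<notin> U" for n by blast
      then obtain z where z: "\<And>n. z n \<in> B (R, l n)" "\<And>n. z n \<notin> U" by metis
      have "(\<lambda>n. z n (d i)) \<longlonglongrightarrow> y (d i)" for i
      proof -
        have "\<bar>z n (d i) - y (d i)\<bar> \<le> 2 / real n" if "n > i" for n
        proof -
          have "\<bar>real n * z n (d i) - \<lfloor>real n * y (d i)\<rfloor>\<bar> \<le> 1"
            using z(1)[of n] that by (auto simp: B_def l_def)
          then have "\<bar>real n * (z n (d i) - y (d i))\<bar> \<le> 2"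
            unfolding right_diff_distrib by linarith
          then have "real n * \<bar>z n (d i) - y (d i)\<bar> \<le> 2" by (simp only: abs_mult abs_of_nat)
          then show ?thesis using that by (simp add: field_simps)
        qed
        then have "\<forall>\<^sub>F n in sequentially. norm (z n (d i) - y (d i)) \<le> 2 / real n"
          by (auto intro: eventually_mono[OF eventually_gt_at_top[of i]])
        moreover have "(\<lambda>n. 2 / real n) \<longlonglongrightarrow> 0" by (rule lim_const_over_n)
        ultimately have "(\<lambda>n. z n (d i) - y (d i)) \<longlonglongrightarrow> 0" by (rule Lim_null_comparison)
        then show ?thesis by (rule LIM_zero_cancel)
      qed
      then have "(\<lambda>n. z n e) \<longlonglongrightarrow> y e" for e
        by (rule blinfun_tendsto_bounded_dense[where R = R, rotated 3])
           (use z(1) R d in \<open>auto simp: B_def\<close>)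
      then have "limitin weak_star_topology z y sequentially" by (rule limitin_weak_star)
      then show False
        using U \<open>y \<in> U\<close> z(2) unfolding limitin_def by auto
    qed
    have "g -` U \<inter> space M = (\<Union>p\<in>{p. B p \<subseteq> U}. {\<omega>\<in>space M. g \<omega> \<in> B p})"
      using key by auto
    moreover have "{\<omega>\<in>space M. g \<omega> \<in> B p} \<in> sets M" for p
      unfolding B_def by (cases p) simp
    ultimately show ?thesis
      by (auto intro!: sets.countable_UN'' )
  qed
  then show "g \<in> M \<rightarrow>\<^sub>M weak_star_borel"
    unfolding weak_star_borel_def by (intro measurable_measure_of) auto
qed

section \<open>Suslin representation of measurable sets\<close>

abbreviation baire_space :: "(nat \<Rightarrow> nat) measure" where
  "baire_space \<equiv> \<Pi>\<^sub>M i\<in>UNIV. count_space UNIV"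

text \<open>The set attached to level \<open>m\<close> sees only the first \<open>m\<close> entries of the branch. Schemes indexed by
finite sequences are thus written as functions of infinite ones, so that recoding the branches of a
scheme is a composition.\<close>

definition prefix_local :: "(nat \<Rightarrow> (nat \<Rightarrow> 'b) \<Rightarrow> 'c) \<Rightarrow> bool" where
  "prefix_local A \<longleftrightarrow> (\<forall>m \<sigma> \<tau>. (\<forall>i<m. \<sigma> i = \<tau> i) \<longrightarrow> A m \<sigma> = A m \<tau>)"

lemma prefix_localD:
  "prefix_local A \<Longrightarrow> (\<And>i. i < m \<Longrightarrow> \<sigma> i = \<tau> i) \<Longrightarrow> A m \<sigma> = A m \<tau>"
  unfolding prefix_local_def by blast

definition suslin_scheme ::
    "'a measure \<Rightarrow> (nat \<Rightarrow> (nat \<Rightarrow> nat \<times> nat) \<Rightarrow> 'a set) \<Rightarrow> bool" where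
  "suslin_scheme M A \<longleftrightarrow> prefix_local A \<and> (\<forall>m \<rho>. A m \<rho> \<in> sets M)"

text \<open>The sequence \<open>\<tau>\<close> is the point of the Baire space and \<open>\<sigma>\<close> the branch of the Suslin operation. Level
\<open>m\<close> inspects the same prefix of both, so that later the two merge into a single branch.\<close>

definition suslin_kernel ::
    "'a measure \<Rightarrow> (nat \<Rightarrow> (nat \<Rightarrow> nat \<times> nat) \<Rightarrow> 'a set) \<Rightarrow> ('a \<times> (nat \<Rightarrow> nat)) set" where
  "suslin_kernel M A = {(\<omega>, \<tau>). \<omega> \<in> space M \<and> (\<exists>\<sigma>. \<forall>m. \<omega> \<in> A m (\<lambda>i. (\<tau> i, \<sigma> i)))}"

definition suslin :: "'a measure \<Rightarrow> ('a \<times> (nat \<Rightarrow> nat)) set \<Rightarrow> bool" where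
  "suslin M H \<longleftrightarrow> (\<exists>A. suslin_scheme M A \<and> H = suslin_kernel M A)"

lemma suslin_cylinder:
  assumes a: "a \<in> sets M"
  shows "suslin M (a \<times> {\<tau>. \<tau> k \<in> X})"
proof -
  define A where "A m \<rho> = (if k < m \<and> fst (\<rho> k) \<notin> X then {} else a)"
    for m and \<rho> :: "nat \<Rightarrow> nat \<times> nat"
  have "suslin_scheme M A"
    using a by (auto simp: suslin_scheme_def prefix_local_def A_def)
  moreover have "(\<omega>, \<tau>) \<in> suslin_kernel M A \<longleftrightarrow> \<omega> \<in> a \<and> \<tau> k \<in> X" for \<omega> \<tau>
  proof
    assume "(\<omega>, \<tau>) \<in> suslin_kernel M A"
    then obtain \<sigma> where "\<And>m. \<omega> \<in> A m (\<lambda>i. (\<tau> i, \<sigma> i))" by (auto simp: suslin_kernel_def)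
    from this[of "Suc k"] show "\<omega> \<in> a \<and> \<tau> k \<in> X" by (auto simp: A_def split: if_splits)
  next
    assume "\<omega> \<in> a \<and> \<tau> k \<in> X"
    then show "(\<omega>, \<tau>) \<in> suslin_kernel M A"
      using sets.sets_into_space[OF a] by (auto simp: suslin_kernel_def A_def)
  qed
  ultimately show ?thesis unfolding suslin_def by (intro exI[of _ A]) auto
qed

text \<open>The first entry of the branch names the set of the union; the remaining entries are its branch.\<close>

lemma suslin_UN:
  assumes "\<And>j::nat. suslin M (H j)"
  shows "suslin M (\<Union>j. H j)"
proof -
  obtain A where "\<And>j. suslin_scheme M (A j)" and H: "\<And>j. H j = suslin_kernel M (A j)"
    using assms unfolding suslin_def by metis
  then have A: "\<And>j. prefix_local (A j)" "\<And>j m \<rho>. A j m \<rho> \<in> sets M"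
    by (auto simp: suslin_scheme_def)
  define B where "B m \<rho> = (case m of 0 \<Rightarrow> space M
     | Suc m' \<Rightarrow> A (snd (\<rho> 0)) m' (\<lambda>i. (fst (\<rho> i), snd (\<rho> (Suc i)))))" for m and \<rho> :: "nat \<Rightarrow> nat \<times> nat"
  have "prefix_local B"
    unfolding prefix_local_def B_def
    by (auto split: nat.split intro!: prefix_localD[OF A(1)])
  moreover have "B m \<rho> \<in> sets M" for m \<rho>
    using A(2) by (auto simp: B_def split: nat.split)
  moreover have "(\<omega>, \<tau>) \<in> (\<Union>j. H j) \<longleftrightarrow> \<omega> \<in> space M \<and> (\<exists>\<sigma>. \<forall>m. \<omega> \<in> B m (\<lambda>i. (\<tau> i, \<sigma> i)))" for \<omega> \<tau>
  proof
    assume "(\<omega>, \<tau>) \<in> (\<Union>j. H j)"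
    then obtain j \<sigma> where *: "\<omega> \<in> space M" "\<And>m. \<omega> \<in> A j m (\<lambda>i. (\<tau> i, \<sigma> i))"
      by (auto simp: H suslin_kernel_def)
    have "\<omega> \<in> B m (\<lambda>i. (\<tau> i, case_nat j \<sigma> i))" for m
      using * by (cases m) (auto simp: B_def)
    with * show "\<omega> \<in> space M \<and> (\<exists>\<sigma>. \<forall>m. \<omega> \<in> B m (\<lambda>i. (\<tau> i, \<sigma> i)))" by blast
  next
    assume "\<omega> \<in> space M \<and> (\<exists>\<sigma>. \<forall>m. \<omega> \<in> B m (\<lambda>i. (\<tau> i, \<sigma> i)))"
    then obtain \<sigma> where \<omega>: "\<omega> \<in> space M" and \<sigma>: "\<And>m. \<omega> \<in> B m (\<lambda>i. (\<tau> i, \<sigma> i))" by blast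
    have "\<omega> \<in> A (\<sigma> 0) m (\<lambda>i. (\<tau> i, \<sigma> (Suc i)))" for m
      using \<sigma>[of "Suc m"] by (simp add: B_def)
    then show "(\<omega>, \<tau>) \<in> (\<Union>j. H j)" using \<omega> by (force simp: H suslin_kernel_def)
  qed
  then have "(\<Union>j. H j) = suslin_kernel M B"
    by (simp only: set_eq_iff split_paired_All suslin_kernel_def mem_Collect_eq prod.case simp_thms)
  ultimately show ?thesis
    unfolding suslin_def suslin_scheme_def by (intro exI[of _ B]) auto
qed

text \<open>Branches for all the sets are interleaved into one by the pairing function. Level \<open>(j, n)\<close>, placed
at position \<open>prod_encode (j, n)\<close>, needs the entries \<open>(j, i)\<close> with \<open>i < n\<close>, which sit at smaller
positions because the pairing function increases in its second argument.\<close>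

lemma suslin_INT:
  assumes "\<And>j::nat. suslin M (H j)"
  shows "suslin M (\<Inter>j. H j)"
proof -
  obtain A where "\<And>j. suslin_scheme M (A j)" and H: "\<And>j. H j = suslin_kernel M (A j)"
    using assms unfolding suslin_def by metis
  then have A: "\<And>j. prefix_local (A j)" "\<And>j m \<rho>. A j m \<rho> \<in> sets M"
    by (auto simp: suslin_scheme_def)
  define B where "B m \<rho> = (case prod_decode m of (j, n) \<Rightarrow>
     A j n (\<lambda>i. (fst (\<rho> i), snd (\<rho> (prod_encode (j, i))))))" for m and \<rho> :: "nat \<Rightarrow> nat \<times> nat"
  have enc: "n \<le> prod_encode (j, n)" "i < n \<Longrightarrow> prod_encode (j, i) < prod_encode (j, n)" for j n i
  proof -
    show "n \<le> prod_encode (j, n)" by (rule le_prod_encode_2)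
    have "triangle p < triangle q" if "p < q" for p q :: nat
      using that by (induction rule: strict_inc_induct) (auto intro: less_trans)
    then show "i < n \<Longrightarrow> prod_encode (j, i) < prod_encode (j, n)"
      by (simp add: prod_encode_def)
  qed
  have "prefix_local B"
    unfolding prefix_local_def
  proof (intro allI impI)
    fix m and \<rho> \<rho>' :: "nat \<Rightarrow> nat \<times> nat" assume eq: "\<forall>i<m. \<rho> i = \<rho>' i"
    obtain j n where jn: "prod_decode m = (j, n)" by fastforce
    then have m: "m = prod_encode (j, n)" by (metis prod_decode_inverse)
    have "\<rho> i = \<rho>' i" "\<rho> (prod_encode (j, i)) = \<rho>' (prod_encode (j, i))" if "i < n" for i
      using eq enc(1)[of n j] enc(2)[OF that, of j] that unfolding m by auto
    then show "B m \<rho> = B m \<rho>'"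
      unfolding B_def jn by (auto intro!: prefix_localD[OF A(1)])
  qed
  moreover have "B m \<rho> \<in> sets M" for m \<rho>
    using A(2) by (auto simp: B_def split: prod.split)
  moreover have "(\<omega>, \<tau>) \<in> (\<Inter>j. H j) \<longleftrightarrow> \<omega> \<in> space M \<and> (\<exists>\<sigma>. \<forall>m. \<omega> \<in> B m (\<lambda>i. (\<tau> i, \<sigma> i)))" for \<omega> \<tau>
  proof
    assume L: "(\<omega>, \<tau>) \<in> (\<Inter>j. H j)"
    then have \<omega>: "\<omega> \<in> space M" by (auto simp: H suslin_kernel_def)
    have "\<forall>j. \<exists>\<sigma>. \<forall>m. \<omega> \<in> A j m (\<lambda>i. (\<tau> i, \<sigma> i))" using L by (simp add: H suslin_kernel_def)
    then obtain s where s: "\<And>j m. \<omega> \<in> A j m (\<lambda>i. (\<tau> i, s j i))" by metis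
    have "\<omega> \<in> B m (\<lambda>i. (\<tau> i, case prod_decode i of (j, k) \<Rightarrow> s j k))" for m
      using s by (auto simp: B_def split: prod.split)
    with \<omega> show "\<omega> \<in> space M \<and> (\<exists>\<sigma>. \<forall>m. \<omega> \<in> B m (\<lambda>i. (\<tau> i, \<sigma> i)))"
      by (intro conjI exI[of _ "\<lambda>i. case prod_decode i of (j, k) \<Rightarrow> s j k"] allI)
  next
    assume "\<omega> \<in> space M \<and> (\<exists>\<sigma>. \<forall>m. \<omega> \<in> B m (\<lambda>i. (\<tau> i, \<sigma> i)))"
    then obtain \<sigma> where \<omega>: "\<omega> \<in> space M" and \<sigma>: "\<And>m. \<omega> \<in> B m (\<lambda>i. (\<tau> i, \<sigma> i))" by blast
    have "\<omega> \<in> A j m (\<lambda>i. (\<tau> i, \<sigma> (prod_encode (j, i))))" for j m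
      using \<sigma>[of "prod_encode (j, m)"] by (simp add: B_def)
    then have "(\<omega>, \<tau>) \<in> H j" for j
      unfolding H suslin_kernel_def using \<omega> by (auto intro!: exI[of _ "\<lambda>i. \<sigma> (prod_encode (j, i))"])
    then show "(\<omega>, \<tau>) \<in> (\<Inter>j. H j)" by blast
  qed
  then have "(\<Inter>j. H j) = suslin_kernel M B"
    by (simp only: set_eq_iff split_paired_All suslin_kernel_def mem_Collect_eq prod.case simp_thms)
  ultimately show ?thesis
    unfolding suslin_def suslin_scheme_def by (intro exI[of _ B]) auto
qed

lemma suslin_Un: "suslin M H \<Longrightarrow> suslin M K \<Longrightarrow> suslin M (H \<union> K)"
proof -
  assume "suslin M H" "suslin M K"
  then have "suslin M (\<Union>j::nat. if j = 0 then H else K)" by (intro suslin_UN) auto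
  moreover have "(\<Union>j::nat. if j = 0 then H else K) = H \<union> K"
    by (auto split: if_splits intro: exI[of _ 0] exI[of _ 1])
  ultimately show ?thesis by simp
qed

text \<open>Suslin sets need not be closed under complements, but the sets that are Suslin together with their
complement form a \<open>\<sigma>\<close>-algebra, and both projections are measurable for it.\<close>

lemma suslin_sets_pair:
  assumes "H \<in> sets (M \<Otimes>\<^sub>M baire_space)"
  shows "suslin M H"
proof -
  let ?\<Omega> = "space M \<times> (UNIV :: (nat \<Rightarrow> nat) set)"
  define \<D> where "\<D> = {H. H \<subseteq> ?\<Omega> \<and> suslin M H \<and> suslin M (?\<Omega> - H)}"
  have cyl: "a \<times> {\<tau>. \<tau> k \<in> X} \<in> \<D>" if a: "a \<in> sets M" for a k X
  proof -
    have "?\<Omega> - a \<times> {\<tau>. \<tau> k \<in> X} = (space M - a) \<times> {\<tau>. \<tau> k \<in> UNIV} \<union> space M \<times> {\<tau>. \<tau> k \<in> - X}"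
      using sets.sets_into_space[OF a] by auto
    moreover have "suslin M \<dots>"
      using a by (intro suslin_Un suslin_cylinder) auto
    ultimately show ?thesis
      using suslin_cylinder[OF a] sets.sets_into_space[OF a] by (auto simp: \<D>_def)
  qed
  have sa: "sigma_algebra ?\<Omega> \<D>"
    unfolding sigma_algebra_iff2
  proof (intro conjI ballI allI impI)
    show "\<D> \<subseteq> Pow ?\<Omega>" by (auto simp: \<D>_def)
    show "{} \<in> \<D>" using cyl[of "{}"] by simp
    show "?\<Omega> - H \<in> \<D>" if "H \<in> \<D>" for H
      using that by (auto simp: \<D>_def double_diff)
    fix F :: "nat \<Rightarrow> _" assume F: "range F \<subseteq> \<D>"
    have eq: "?\<Omega> - (\<Union>i. F i) = (\<Inter>i. ?\<Omega> - F i)" by auto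
    have "suslin M (\<Inter>i. ?\<Omega> - F i)"
      by (rule suslin_INT) (use F in \<open>auto simp: \<D>_def\<close>)
    moreover have "suslin M (\<Union>i. F i)"
      by (rule suslin_UN) (use F in \<open>auto simp: \<D>_def\<close>)
    ultimately show "(\<Union>i. F i) \<in> \<D>" using F unfolding \<D>_def mem_Collect_eq eq by blast
  qed
  define Q where "Q = measure_of ?\<Omega> \<D> (\<lambda>_. 0)"
  have Q: "sets Q = \<D>" "space Q = ?\<Omega>"
    unfolding Q_def using sigma_algebra.sets_measure_of_eq[OF sa]
    by (simp, intro space_measure_of) (auto simp: \<D>_def)
  have 1: "fst \<in> Q \<rightarrow>\<^sub>M M"
  proof (rule measurableI)
    fix a assume a: "a \<in> sets M"
    have "fst -` a \<inter> space Q = a \<times> {\<tau>. \<tau> 0 \<in> UNIV}"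
      using sets.sets_into_space[OF a] by (auto simp: Q)
    then show "fst -` a \<inter> space Q \<in> sets Q" using cyl[OF a, of 0 UNIV] Q by simp
  qed (auto simp: Q)
  have 2: "snd \<in> Q \<rightarrow>\<^sub>M baire_space"
  proof (rule measurable_PiM_single)
    fix X :: "nat set" and k
    have "{p \<in> space Q. snd p k \<in> X} = space M \<times> {\<tau>. \<tau> k \<in> X}"
      by (auto simp: Q)
    then show "{p \<in> space Q. snd p k \<in> X} \<in> sets Q"
      using cyl[OF sets.top, of k X] Q by simp
  qed auto
  have "(\<lambda>p. (fst p, snd p)) \<in> Q \<rightarrow>\<^sub>M (M \<Otimes>\<^sub>M baire_space)"
    using 1 2 by (rule measurable_Pair)
  from measurable_sets[OF this assms] have "H \<inter> ?\<Omega> \<in> \<D>"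
    by (simp add: Q)
  moreover have "H \<subseteq> ?\<Omega>"
    using sets.sets_into_space[OF assms] by (auto simp: space_pair_measure)
  ultimately show ?thesis by (simp add: \<D>_def Int_absorb2)
qed

section \<open>Measurable selection over the Baire space\<close>

text \<open>The quantifier over branches is uncountable, but the first \<open>n\<close> levels depend only on a finite prefix
of the branch, so that the set is a countable union.\<close>

lemma sets_ex_prefix_local:
  fixes A :: "nat \<Rightarrow> (nat \<Rightarrow> 'b::countable) \<Rightarrow> 'a set"
  assumes A: "prefix_local A" "\<And>m \<rho>. A m \<rho> \<in> sets M"
  shows "{\<omega>\<in>space M. \<exists>\<rho>. Q \<rho> \<and> (\<forall>m\<le>n. \<omega> \<in> A m \<rho>)} \<in> sets M"
proof -
  define P where "P l = (\<lambda>i. if i < length l then l ! i else undefined)" for l :: "'b list"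
  have P: "A m \<rho> = A m (P (map \<rho> [0..<n]))" if "m \<le> n" for m \<rho>
    using that by (intro prefix_localD[OF A(1)]) (simp add: P_def)
  have "{\<omega>\<in>space M. \<exists>\<rho>. Q \<rho> \<and> (\<forall>m\<le>n. \<omega> \<in> A m \<rho>)}
    = {\<omega>\<in>space M. \<exists>\<rho>. Q \<rho> \<and> (\<forall>m\<le>n. \<omega> \<in> A m (P (map \<rho> [0..<n])))}"
    by (simp add: P[symmetric])
  also have "\<dots> = (\<Union>l\<in>{map \<rho> [0..<n] |\<rho>. Q \<rho>}. {\<omega>\<in>space M. \<forall>m\<in>{..n}. \<omega> \<in> A m (P l)})"
    by blast
  also have "\<dots> \<in> sets M"
    using A(2) by (intro sets.countable_UN'' sets.sets_Collect_finite_All) auto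
  finally show ?thesis .
qed

text \<open>The finite sequence \<open>l\<close> can be continued, within the bounds \<open>b\<close>, to branches that pass any given
number of levels. By compactness (the next lemma and its iteration) this amounts to the existence
of one branch through \<open>l\<close> that passes all levels, but in this form it is visibly measurable.\<close>

definition viable ::
    "(nat \<Rightarrow> (nat \<Rightarrow> nat) \<Rightarrow> 'a set) \<Rightarrow> (nat \<Rightarrow> nat) \<Rightarrow> nat list \<Rightarrow> 'a \<Rightarrow> bool" where
  "viable A b l \<omega> \<longleftrightarrow> (\<forall>n. \<exists>\<rho>. ((\<forall>i. \<rho> i \<le> b i) \<and> (\<forall>i<length l. \<rho> i = l ! i)) \<and> (\<forall>m\<le>n. \<omega> \<in> A m \<rho>))"

text \<open>Koenig's argument: if each of the finitely many admissible entries failed at some level, then all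
of them would fail at the largest of these levels.\<close>

lemma viable_extend:
  assumes "viable A b l \<omega>"
  shows "\<exists>k. viable A b (l @ [k]) \<omega>"
proof (rule ccontr)
  assume "\<nexists>k. viable A b (l @ [k]) \<omega>"
  then have "\<forall>k. \<exists>n. \<not> (\<exists>\<rho>. ((\<forall>i. \<rho> i \<le> b i) \<and> (\<forall>i<length (l @ [k]). \<rho> i = (l @ [k]) ! i)) \<and>
      (\<forall>m\<le>n. \<omega> \<in> A m \<rho>))"
    unfolding viable_def by blast
  from choice[OF this] obtain N where N: "\<And>k \<rho>. \<lbrakk>\<forall>i. \<rho> i \<le> b i;
      \<forall>i<length (l @ [k]). \<rho> i = (l @ [k]) ! i; \<forall>m\<le>N k. \<omega> \<in> A m \<rho>\<rbrakk> \<Longrightarrow> False"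
    by blast
  define n where "n = Max (N ` {..b (length l)})"
  obtain \<rho> where \<rho>: "\<And>i. \<rho> i \<le> b i" "\<And>i. i < length l \<Longrightarrow> \<rho> i = l ! i" "\<And>m. m \<le> n \<Longrightarrow> \<omega> \<in> A m \<rho>"
    using assms[unfolded viable_def, rule_format, of n] by blast
  have "N (\<rho> (length l)) \<le> n"
    unfolding n_def using \<rho>(1) by (intro Max_ge) auto
  then show False
    using \<rho> by (intro N[of \<rho> "\<rho> (length l)"]) (auto simp: nth_append less_Suc_eq)
qed

lemma sets_viable:
  assumes A: "prefix_local A" "\<And>m \<rho>. A m \<rho> \<in> sets M"
  shows "{\<omega>\<in>space M. viable A b l \<omega>} \<in> sets M"
  unfolding viable_def using A by (intro sets.sets_Collect_countable_All sets_ex_prefix_local)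

primrec leftmost_branch ::
    "(nat \<Rightarrow> (nat \<Rightarrow> nat) \<Rightarrow> 'a set) \<Rightarrow> (nat \<Rightarrow> nat) \<Rightarrow> nat \<Rightarrow> 'a \<Rightarrow> nat list" where
  "leftmost_branch A b 0 \<omega> = []"
| "leftmost_branch A b (Suc n) \<omega> =
     leftmost_branch A b n \<omega> @ [LEAST k. viable A b (leftmost_branch A b n \<omega> @ [k]) \<omega>]"

lemma length_leftmost_branch [simp]: "length (leftmost_branch A b n \<omega>) = n"
  by (induction n) auto

lemma nth_leftmost_branch:
  "i < n \<Longrightarrow> leftmost_branch A b n \<omega> ! i = leftmost_branch A b (Suc i) \<omega> ! i"
  by (induction n) (auto simp: nth_append less_Suc_eq)

lemma viable_leftmost_branch:
  "viable A b [] \<omega> \<Longrightarrow> viable A b (leftmost_branch A b n \<omega>) \<omega>"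
  by (induction n) (auto intro: LeastI_ex viable_extend)

lemma measurable_leftmost_branch:
  assumes A: "prefix_local A" "\<And>m \<rho>. A m \<rho> \<in> sets M"
  shows "leftmost_branch A b n \<in> M \<rightarrow>\<^sub>M count_space UNIV"
proof (induction n)
  case (Suc n)
  have [measurable]: "Measurable.pred M (viable A b l)" for l
    using sets_viable[OF A] by (simp add: pred_def)
  have "(\<lambda>\<omega>. (\<lambda>l \<omega>. l @ [LEAST k. viable A b (l @ [k]) \<omega>]) (leftmost_branch A b n \<omega>) \<omega>)
    \<in> M \<rightarrow>\<^sub>M count_space UNIV"
    by (rule measurable_compose_countable[OF _ Suc]) measurable
  then show ?case by simp
qed simp

lemma viable_Nil_selection:
  fixes A :: "nat \<Rightarrow> (nat \<Rightarrow> nat) \<Rightarrow> 'a set"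
  assumes A: "prefix_local A" "\<And>m \<rho>. A m \<rho> \<in> sets M"
  obtains \<rho> where "\<rho> \<in> M \<rightarrow>\<^sub>M baire_space"
    and "\<And>\<omega> m. viable A b [] \<omega> \<Longrightarrow> \<omega> \<in> A m (\<rho> \<omega>)"
proof
  let ?\<rho> = "\<lambda>\<omega> i. leftmost_branch A b (Suc i) \<omega> ! i"
  show "?\<rho> \<in> M \<rightarrow>\<^sub>M baire_space"
  proof (rule measurable_PiM_single')
    fix i
    show "(\<lambda>\<omega>. leftmost_branch A b (Suc i) \<omega> ! i) \<in> M \<rightarrow>\<^sub>M count_space UNIV"
      by (rule measurable_compose[OF measurable_leftmost_branch[OF A]]) simp
  qed auto
  fix \<omega> m assume "viable A b [] \<omega>"
  then have "viable A b (leftmost_branch A b m \<omega>) \<omega>" by (rule viable_leftmost_branch)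
  from this[unfolded viable_def, rule_format, of m]
  obtain \<rho> where \<rho>: "\<And>i. i < m \<Longrightarrow> \<rho> i = leftmost_branch A b m \<omega> ! i" "\<omega> \<in> A m \<rho>"
    by auto
  have "A m \<rho> = A m (?\<rho> \<omega>)"
    by (rule prefix_localD[OF A(1)]) (simp only: \<rho>(1) nth_leftmost_branch[of _ m])
  then show "\<omega> \<in> A m (?\<rho> \<omega>)" using \<rho>(2) by simp
qed

text \<open>The capacitability argument. Bounding the next entry of the branch by \<open>k\<close> gives sets that increase
with \<open>k\<close> to the whole, and outer measure is continuous along increasing sequences of arbitrary
sets; so the entries can be bounded one after the other while the outer measure stays above \<open>\<alpha>\<close>.\<close>

lemma suslin_bounded_branches:
  fixes A :: "nat \<Rightarrow> (nat \<Rightarrow> nat) \<Rightarrow> 'a set"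
  assumes \<alpha>: "\<alpha> < outer_measure_of M {\<omega>\<in>space M. \<exists>\<rho>. \<forall>m. \<omega> \<in> A m \<rho>}"
  obtains b where "\<And>n. \<alpha> < outer_measure_of M
    {\<omega>\<in>space M. \<exists>\<rho>. (\<forall>i<n. \<rho> i \<le> b i) \<and> (\<forall>m. \<omega> \<in> A m \<rho>)}"
proof -
  define S where "S l = {\<omega>\<in>space M. \<exists>\<rho>. (\<forall>i<length l. \<rho> i \<le> l ! i) \<and> (\<forall>m. \<omega> \<in> A m \<rho>)}" for l
  have "\<exists>L. \<forall>n. (length (L n) = n \<and> \<alpha> < outer_measure_of M (S (L n))) \<and> (\<exists>k. L (Suc n) = L n @ [k])"
  proof (rule dependent_nat_choice)
    show "\<exists>l. length l = 0 \<and> \<alpha> < outer_measure_of M (S l)"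
      using \<alpha> by (simp add: S_def)
  next
    fix l n assume l: "length l = n \<and> \<alpha> < outer_measure_of M (S l)"
    have "S l = (\<Union>k. S (l @ [k]))"
    proof (intro set_eqI iffI)
      fix \<omega> assume "\<omega> \<in> S l"
      then obtain \<rho> where "\<omega> \<in> space M" "\<And>i. i < length l \<Longrightarrow> \<rho> i \<le> l ! i" "\<And>m. \<omega> \<in> A m \<rho>"
        unfolding S_def by blast
      then have "\<omega> \<in> S (l @ [\<rho> (length l)])"
        unfolding S_def by (auto intro!: exI[of _ \<rho>] simp: nth_append less_Suc_eq)
      then show "\<omega> \<in> (\<Union>k. S (l @ [k]))" by blast
    next
      fix \<omega> assume "\<omega> \<in> (\<Union>k. S (l @ [k]))"
      then obtain k \<rho> where "\<omega> \<in> space M" "\<And>i. i < Suc (length l) \<Longrightarrow> \<rho> i \<le> (l @ [k]) ! i" "\<And>m. \<omega> \<in> A m \<rho>"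
        unfolding S_def by auto
      then show "\<omega> \<in> S l"
        unfolding S_def by (auto intro!: exI[of _ \<rho>] simp: nth_append) (metis less_Suc_eq)
    qed
    moreover have "incseq (\<lambda>k. S (l @ [k]))"
    proof (rule incseq_SucI, rule subsetI)
      fix k \<omega> assume "\<omega> \<in> S (l @ [k])"
      then obtain \<rho> where "\<omega> \<in> space M" "\<And>i. i < Suc (length l) \<Longrightarrow> \<rho> i \<le> (l @ [k]) ! i" "\<And>m. \<omega> \<in> A m \<rho>"
        unfolding S_def by auto
      moreover from this(2) have "\<rho> i \<le> (l @ [Suc k]) ! i" if "i < Suc (length l)" for i
        using that by (fastforce simp: nth_append split: if_splits)
      ultimately show "\<omega> \<in> S (l @ [Suc k])" unfolding S_def by auto
    qed
    ultimately have "(SUP k. outer_measure_of M (S (l @ [k]))) = outer_measure_of M (S l)"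
      by (subst SUP_outer_measure_of_incseq) (auto simp: S_def)
    with l have "\<alpha> < (SUP k. outer_measure_of M (S (l @ [k])))" by simp
    then obtain k where "\<alpha> < outer_measure_of M (S (l @ [k]))" by (auto simp: less_SUP_iff)
    with l show "\<exists>l'. (length l' = Suc n \<and> \<alpha> < outer_measure_of M (S l')) \<and> (\<exists>k. l' = l @ [k])"
      by (intro exI[of _ "l @ [k]"]) auto
  qed
  then obtain L where L: "\<And>n. length (L n) = n" "\<And>n. \<alpha> < outer_measure_of M (S (L n))"
    "\<And>n. \<exists>k. L (Suc n) = L n @ [k]" by blast
  have nth: "L n ! i = L (Suc i) ! i" if "i < n" for n i
    using that
  proof (induction n)
    case (Suc n)
    obtain k where "L (Suc n) = L n @ [k]" using L(3) by blast
    with Suc show ?case by (cases "i = n") (auto simp: nth_append L(1))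
  qed simp
  show thesis
  proof (rule that[of "\<lambda>i. L (Suc i) ! i"])
    fix n
    have "S (L n) = {\<omega>\<in>space M. \<exists>\<rho>. (\<forall>i<n. \<rho> i \<le> L (Suc i) ! i) \<and> (\<forall>m. \<omega> \<in> A m \<rho>)}"
      unfolding S_def L(1) by (simp add: nth[symmetric] cong: conj_cong)
    then show "\<alpha> < outer_measure_of M {\<omega>\<in>space M. \<exists>\<rho>. (\<forall>i<n. \<rho> i \<le> L (Suc i) ! i) \<and> (\<forall>m. \<omega> \<in> A m \<rho>)}"
      using L(2)[of n] by simp
  qed
qed

text \<open>With bounded entries, the sets \<open>J n\<close> of points that pass the first \<open>n\<close> levels are measurable of
measure at least \<open>\<alpha>\<close>, and they decrease to the set of points that have a bounded branch.\<close>

lemma suslin_inner_selection: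
  fixes A :: "nat \<Rightarrow> (nat \<Rightarrow> nat) \<Rightarrow> 'a set"
  assumes M: "finite_measure M"
    and A: "prefix_local A" "\<And>m \<rho>. A m \<rho> \<in> sets M"
    and \<alpha>: "\<alpha> < outer_measure_of M {\<omega>\<in>space M. \<exists>\<rho>. \<forall>m. \<omega> \<in> A m \<rho>}"
  obtains W \<rho> where "W \<in> sets M" "\<alpha> \<le> emeasure M W" "\<rho> \<in> M \<rightarrow>\<^sub>M baire_space"
    "\<And>\<omega> m. \<omega> \<in> W \<Longrightarrow> \<omega> \<in> A m (\<rho> \<omega>)"
proof -
  interpret finite_measure M by fact
  obtain b where b: "\<And>n. \<alpha> < outer_measure_of M
    {\<omega>\<in>space M. \<exists>\<rho>. (\<forall>i<n. \<rho> i \<le> b i) \<and> (\<forall>m. \<omega> \<in> A m \<rho>)}"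
    using suslin_bounded_branches[OF \<alpha>] by blast
  define J where "J n = {\<omega>\<in>space M. \<exists>\<rho>. (\<forall>i. \<rho> i \<le> b i) \<and> (\<forall>m\<le>n. \<omega> \<in> A m \<rho>)}" for n
  have J: "J n \<in> sets M" for n unfolding J_def by (rule sets_ex_prefix_local[OF A])
  have le: "\<alpha> \<le> emeasure M (J n)" for n
  proof -
    have "{\<omega>\<in>space M. \<exists>\<rho>. (\<forall>i<n. \<rho> i \<le> b i) \<and> (\<forall>m. \<omega> \<in> A m \<rho>)} \<subseteq> J n"
    proof safe
      fix \<omega> \<rho> assume \<omega>: "\<omega> \<in> space M" "\<forall>i<n. \<rho> i \<le> b i" "\<forall>m. \<omega> \<in> A m \<rho>"
      \<comment> \<open>The entries from position \<open>n\<close> on are irrelevant for the first \<open>n\<close> levels and may be set to \<open>0\<close>.\<close>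
      have "A m \<rho> = A m (\<lambda>i. if i < n then \<rho> i else 0)" if "m \<le> n" for m
        using that by (intro prefix_localD[OF A(1)]) simp
      with \<omega> show "\<omega> \<in> J n"
        unfolding J_def by (auto intro!: exI[of _ "\<lambda>i. if i < n then \<rho> i else 0"])
    qed
    from outer_measure_of_mono[OF this, of M] b[of n] J[of n] show ?thesis by simp
  qed
  have "decseq J" unfolding J_def by (rule decseq_SucI) (blast intro: le_SucI)
  then have "(INF n. emeasure M (J n)) = emeasure M (\<Inter>n. J n)"
    using J by (intro INF_emeasure_decseq) auto
  moreover have "\<alpha> \<le> (INF n. emeasure M (J n))" using le by (rule INF_greatest)
  moreover have "(\<Inter>n. J n) = {\<omega>\<in>space M. viable A b [] \<omega>}"
    unfolding J_def viable_def by auto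
  ultimately have *: "\<alpha> \<le> emeasure M {\<omega>\<in>space M. viable A b [] \<omega>}" by simp
  obtain \<rho> where "\<rho> \<in> M \<rightarrow>\<^sub>M baire_space" "\<And>\<omega> m. viable A b [] \<omega> \<Longrightarrow> \<omega> \<in> A m (\<rho> \<omega>)"
    using viable_Nil_selection[OF A] by blast
  then show thesis
    by (intro that[OF sets_viable[OF A] *]) auto
qed

text \<open>Exhaust the projection by the sets of the previous lemma, whose measures approach its outer
measure, and use at each point the first available selection.\<close>

lemma suslin_selection_finite:
  fixes A :: "nat \<Rightarrow> (nat \<Rightarrow> nat) \<Rightarrow> 'a set"
  assumes M: "finite_measure M"
    and A: "prefix_local A" "\<And>m \<rho>. A m \<rho> \<in> sets M"
  obtains W \<rho> where "W \<in> sets M" "\<rho> \<in> M \<rightarrow>\<^sub>M baire_space"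
    "\<And>\<omega> m. \<omega> \<in> W \<Longrightarrow> \<omega> \<in> A m (\<rho> \<omega>)"
    "AE \<omega> in M. (\<exists>\<rho>. \<forall>m. \<omega> \<in> A m \<rho>) \<longrightarrow> \<omega> \<in> W"
proof -
  interpret finite_measure M by fact
  define P where "P = {\<omega>\<in>space M. \<exists>\<rho>. \<forall>m. \<omega> \<in> A m \<rho>}"
  obtain E where E: "E \<in> sets M" "P \<subseteq> E" "outer_measure_of M P = emeasure M E"
    using outer_measure_of_attain[of P M] by (auto simp: P_def)
  have "\<exists>W \<rho>. W \<in> sets M \<and> measure M E \<le> measure M W + inverse (real (Suc j)) \<and>
    \<rho> \<in> M \<rightarrow>\<^sub>M baire_space \<and> (\<forall>\<omega>\<in>W. \<forall>m. \<omega> \<in> A m (\<rho> \<omega>))" for j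
  proof (cases "measure M E \<le> inverse (real (Suc j))")
    case True
    then show ?thesis
      by (intro exI[of _ "{}"] exI[of _ "\<lambda>_ _. 0"]) (auto simp: space_PiM simp del: of_nat_Suc)
  next
    case False
    define \<alpha> where "\<alpha> = measure M E - inverse (real (Suc j))"
    have \<alpha>: "0 \<le> \<alpha>" "\<alpha> < measure M E" using False by (simp_all add: \<alpha>_def del: of_nat_Suc)
    then have "ennreal \<alpha> < outer_measure_of M P"
      unfolding E(3) emeasure_eq_measure by (simp add: ennreal_less_iff)
    from suslin_inner_selection[OF M A this[unfolded P_def]] obtain W \<rho>
      where W: "W \<in> sets M" "ennreal \<alpha> \<le> emeasure M W"
        "\<rho> \<in> M \<rightarrow>\<^sub>M baire_space" "\<And>\<omega> m. \<omega> \<in> W \<Longrightarrow> \<omega> \<in> A m (\<rho> \<omega>)" by blast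
    have "\<alpha> \<le> measure M W"
      using W(2) by (simp add: emeasure_eq_measure ennreal_le_iff)
    then have "measure M E \<le> measure M W + inverse (real (Suc j))" unfolding \<alpha>_def by linarith
    with W show ?thesis by blast
  qed
  then obtain W \<rho> where "\<forall>j. W j \<in> sets M \<and> measure M E \<le> measure M (W j) + inverse (real (Suc j)) \<and>
    \<rho> j \<in> M \<rightarrow>\<^sub>M baire_space \<and> (\<forall>\<omega>\<in>W j. \<forall>m. \<omega> \<in> A m (\<rho> j \<omega>))"
    by metis
  then have W: "\<And>j. W j \<in> sets M" "\<And>j. measure M E \<le> measure M (W j) + inverse (real (Suc j))"
    "\<And>j. \<rho> j \<in> M \<rightarrow>\<^sub>M baire_space" "\<And>j \<omega> m. \<omega> \<in> W j \<Longrightarrow> \<omega> \<in> A m (\<rho> j \<omega>)"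
    by blast+
  define U where "U = (\<Union>j. W j)"
  have U: "U \<in> sets M" unfolding U_def using W(1) by blast
  have sub: "W j \<subseteq> E" for j
    using W(4) E(2) sets.sets_into_space[OF W(1)] unfolding P_def by fastforce
  define \<rho>' where "\<rho>' \<omega> = \<rho> (LEAST j. \<omega> \<in> W j) \<omega>" for \<omega>
  show thesis
  proof (rule that[OF U])
    note [measurable] = W(1)
    have "(\<lambda>\<omega>. LEAST j. \<omega> \<in> W j) \<in> M \<rightarrow>\<^sub>M count_space UNIV" by measurable
    then show "\<rho>' \<in> M \<rightarrow>\<^sub>M baire_space"
      unfolding \<rho>'_def using W(3) by (rule measurable_compose_countable[rotated])
    show "\<omega> \<in> A m (\<rho>' \<omega>)" if "\<omega> \<in> U" for \<omega> m
    proof -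
      have "\<omega> \<in> W (LEAST j. \<omega> \<in> W j)" using that unfolding U_def by (auto intro: LeastI)
      then show ?thesis unfolding \<rho>'_def by (rule W(4))
    qed
    have "measure M (E - U) \<le> inverse (real (Suc j))" for j
    proof -
      note W(2)[of j]
      moreover have "measure M (W j) \<le> measure M U"
        using U unfolding U_def by (intro finite_measure_mono) auto
      moreover have "measure M (E - U) = measure M E - measure M U"
        using E(1) U sub by (intro finite_measure_Diff) (auto simp: U_def)
      ultimately show ?thesis by linarith
    qed
    then have "measure M (E - U) \<le> 0"
      by (intro LIMSEQ_le_const[OF LIMSEQ_inverse_real_of_nat]) auto
    then have "E - U \<in> null_sets M"
      using E(1) U by (simp add: null_sets_def emeasure_eq_measure measure_le_0_iff)
    then show "AE \<omega> in M. (\<exists>\<rho>. \<forall>m. \<omega> \<in> A m \<rho>) \<longrightarrow> \<omega> \<in> U"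
    proof (rule AE_I')
      show "{\<omega> \<in> space M. \<not> ((\<exists>\<rho>. \<forall>m. \<omega> \<in> A m \<rho>) \<longrightarrow> \<omega> \<in> U)} \<subseteq> E - U"
        using E(2) unfolding P_def by blast
    qed
  qed
qed

text \<open>A selection theorem only sees measurable sets and null sets, so it may be proved for an equivalent
finite measure. There, measurable subsets of the projection whose measures approach its outer measure
exhaust it up to a null set.\<close>

lemma sigma_finite_equivalent_finite:
  assumes "sigma_finite_measure M"
  obtains N where "finite_measure N" "sets N = sets M" "\<And>P. (AE \<omega> in N. P \<omega>) \<longleftrightarrow> (AE \<omega> in M. P \<omega>)"
proof -
  interpret sigma_finite_measure M by fact
  obtain h :: "'a \<Rightarrow> real" where h: "h \<in> borel_measurable M" "\<And>x. h x > 0" "integrable M h"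
    by (rule obtain_positive_integrable_function) blast
  show thesis
  proof (rule that[of "density M h"])
    have "emeasure (density M h) (space M) = (\<integral>\<^sup>+x. ennreal (h x) \<partial>M)"
      using h(1) by (auto simp: emeasure_density intro!: nn_integral_cong)
    also have "\<dots> < \<infinity>"
      using h by (auto simp: nn_integral_eq_integral less_imp_le)
    finally show "finite_measure (density M h)"
      by (intro finite_measureI) simp
    show "(AE \<omega> in density M h. P \<omega>) \<longleftrightarrow> (AE \<omega> in M. P \<omega>)" for P
      using h by (subst AE_density) auto
  qed simp
qed

text \<open>The point \<open>\<tau>\<close> and the branch \<open>\<sigma>\<close> that puts it into the Suslin set are merged into the single branch
\<open>\<lambda>i. prod_encode (\<tau> i, \<sigma> i)\<close>; selecting that branch selects \<open>\<tau>\<close>.\<close>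

proposition measurable_selection_baire:
  assumes M: "sigma_finite_measure M" and H: "H \<in> sets (M \<Otimes>\<^sub>M baire_space)"
  obtains W \<tau> where "W \<in> sets M" "\<tau> \<in> M \<rightarrow>\<^sub>M baire_space"
    "\<And>\<omega>. \<omega> \<in> W \<Longrightarrow> (\<omega>, \<tau> \<omega>) \<in> H" "AE \<omega> in M. (\<exists>\<tau>. (\<omega>, \<tau>) \<in> H) \<longrightarrow> \<omega> \<in> W"
proof -
  obtain N where N: "finite_measure N" "sets N = sets M" "\<And>P. (AE \<omega> in N. P \<omega>) \<longleftrightarrow> (AE \<omega> in M. P \<omega>)"
    using sigma_finite_equivalent_finite[OF M] by blast
  obtain A where A: "prefix_local A" "\<And>m \<rho>. A m \<rho> \<in> sets M" and HA: "H = suslin_kernel M A"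
    using suslin_sets_pair[OF H] by (auto simp: suslin_def suslin_scheme_def)
  define B where "B m \<rho> = A m (\<lambda>i. prod_decode (\<rho> i))" for m \<rho>
  have B: "prefix_local B" "\<And>m \<rho>. B m \<rho> \<in> sets N"
    using A by (auto simp: B_def N(2) prefix_local_def)
  obtain W \<rho> where W: "W \<in> sets N" "\<rho> \<in> N \<rightarrow>\<^sub>M baire_space"
    "\<And>\<omega> m. \<omega> \<in> W \<Longrightarrow> \<omega> \<in> B m (\<rho> \<omega>)" "AE \<omega> in N. (\<exists>\<rho>. \<forall>m. \<omega> \<in> B m \<rho>) \<longrightarrow> \<omega> \<in> W"
    using suslin_selection_finite[OF N(1) B] by blast
  show thesis
  proof
    show WM: "W \<in> sets M" using W(1) N(2) by simp
    have \<rho>: "\<rho> \<in> M \<rightarrow>\<^sub>M baire_space" using W(2) measurable_cong_sets[OF N(2) refl] by blast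
    show "(\<lambda>\<omega> i. fst (prod_decode (\<rho> \<omega> i))) \<in> M \<rightarrow>\<^sub>M baire_space"
    proof (rule measurable_PiM_single')
      fix i :: nat
      have "(\<lambda>\<omega>. \<rho> \<omega> i) \<in> M \<rightarrow>\<^sub>M count_space UNIV"
        using measurable_compose[OF \<rho> measurable_component_singleton[of i]] by simp
      then show "(\<lambda>\<omega>. fst (prod_decode (\<rho> \<omega> i))) \<in> M \<rightarrow>\<^sub>M count_space UNIV"
        by (rule measurable_compose) simp
    qed auto
    show "(\<omega>, \<lambda>i. fst (prod_decode (\<rho> \<omega> i))) \<in> H" if "\<omega> \<in> W" for \<omega>
      using W(3)[OF that] sets.sets_into_space[OF WM] that
      by (auto simp: HA suslin_kernel_def B_def intro!: exI[of _ "\<lambda>i. snd (prod_decode (\<rho> \<omega> i))"])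
    have "\<exists>\<rho>. \<forall>m. \<omega> \<in> B m \<rho>" if "(\<omega>, \<tau>) \<in> H" for \<omega> \<tau>
    proof -
      from that have "\<exists>\<sigma>. \<forall>m. \<omega> \<in> A m (\<lambda>i. (\<tau> i, \<sigma> i))"
        by (simp add: HA suslin_kernel_def)
      then obtain \<sigma> where "\<forall>m. \<omega> \<in> A m (\<lambda>i. (\<tau> i, \<sigma> i))" by (rule exE)
      then show ?thesis
        by (intro exI[of _ "\<lambda>i. prod_encode (\<tau> i, \<sigma> i)"]) (simp add: B_def)
    qed
    then show "AE \<omega> in M. (\<exists>\<tau>. (\<omega>, \<tau>) \<in> H) \<longrightarrow> \<omega> \<in> W"
      using W(4) unfolding N(3) by (auto elim: eventually_mono)
  qed
qed

section \<open>Coding the dual by the Baire space\<close>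

text \<open>The defect \<open>h t = g (t *\<^sub>R e) - t * g e\<close> from homogeneity is additive in \<open>t\<close> and vanishes on the
integers, hence it is bounded; a bounded additive function is zero.\<close>

lemma lipschitz_additive_imp_linear:
  fixes g :: "'e::real_normed_vector \<Rightarrow> real"
  assumes add: "\<And>a b. g (a + b) = g a + g b" and bd: "\<And>e. \<bar>g e\<bar> \<le> R * norm e"
  shows "bounded_linear g"
proof (rule bounded_linear_intro)
  fix r :: real and e :: 'e
  define h where "h t = g (t *\<^sub>R e) - t * g e" for t
  have h_add: "h (s + t) = h s + h t" for s t
    by (simp add: h_def scaleR_add_left add algebra_simps)
  have h0: "h 0 = 0" using h_add[of 0 0] by simp
  have h_nat: "h (of_nat n * t) = of_nat n * h t" for n t
    by (induction n) (simp_all add: h0 h_add distrib_right)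
  have h_int: "h (of_int k) = 0" for k
  proof -
    have h1: "h (real n) = 0" for n using h_nat[of n 1] by (simp add: h_def)
    show ?thesis
    proof (cases "k \<ge> 0")
      case True then show ?thesis using h1[of "nat k"] by simp
    next
      case False
      then have "h (real (nat (- k)) + of_int k) = h (of_int k)" using h1 by (simp only: h_add)
      with False h0 show ?thesis by simp
    qed
  qed
  define K where "K = (\<bar>R\<bar> * norm e + \<bar>g e\<bar>)"
  have K: "\<bar>h t\<bar> \<le> K" for t
  proof -
    have "h t = h (frac t)" using h_add[of "of_int \<lfloor>t\<rfloor>" "frac t"] h_int by (simp add: frac_def)
    moreover have "\<bar>h (frac t)\<bar> \<le> \<bar>g (frac t *\<^sub>R e)\<bar> + \<bar>frac t * g e\<bar>"
      unfolding h_def by (rule abs_triangle_ineq4)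
    moreover have "\<bar>g (frac t *\<^sub>R e)\<bar> \<le> \<bar>R\<bar> * norm e"
    proof -
      have "\<bar>g (frac t *\<^sub>R e)\<bar> \<le> R * (frac t * norm e)" using bd[of "frac t *\<^sub>R e"] by simp
      also have "\<dots> \<le> \<bar>R\<bar> * (1 * norm e)"
        by (intro mult_mono) (auto simp: less_imp_le[OF frac_lt_1] intro!: mult_left_le_one_le)
      finally show ?thesis by simp
    qed
    moreover have "\<bar>frac t * g e\<bar> \<le> \<bar>g e\<bar>"
      by (simp add: abs_mult mult_left_le_one_le less_imp_le[OF frac_lt_1])
    ultimately show ?thesis unfolding K_def by linarith
  qed
  have "h r = 0"
  proof (rule ccontr)
    assume "h r \<noteq> 0"
    then obtain n :: nat where "K < of_nat n * \<bar>h r\<bar>"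
      using ex_less_of_nat_mult[of "\<bar>h r\<bar>" K] by auto
    also have "\<dots> = \<bar>h (of_nat n * r)\<bar>" by (simp add: h_nat abs_mult)
    finally show False using K[of "of_nat n * r"] by linarith
  qed
  then show "g (r *\<^sub>R e) = r *\<^sub>R g e" by (simp add: h_def)
next
  show "norm (g e) \<le> norm e * R" for e using bd[of e] by (simp add: mult.commute)
qed (rule add)

text \<open>A sequence of prescribed values on a dense sequence \<open>d\<close> comes from a functional if and only if it is
Lipschitz on the additive monoid generated by \<open>d\<close>: the Lipschitz extension is then additive by
density. The right hand side involves only countably many conditions on \<open>r\<close>, which makes the set
of admissible \<open>r\<close> measurable.\<close>

lemma functional_from_dense_values:
  fixes d :: "nat \<Rightarrow> 'e::real_normed_vector" and r :: "nat \<Rightarrow> real"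
  assumes d: "closure (range d) = UNIV"
  shows "(\<exists>y :: 'e \<Rightarrow>\<^sub>L real. \<forall>i. y (d i) = r i) \<longleftrightarrow>
    (\<exists>R::nat. \<forall>k l. \<bar>sum_list (map r k) - sum_list (map r l)\<bar>
       \<le> real R * norm (sum_list (map d k) - sum_list (map d l)))"
proof
  assume "\<exists>y :: 'e \<Rightarrow>\<^sub>L real. \<forall>i. y (d i) = r i"
  then obtain y :: "'e \<Rightarrow>\<^sub>L real" where y: "\<And>i. y (d i) = r i" by blast
  have sum: "y (sum_list (map d k)) = sum_list (map r k)" for k
    by (induction k) (simp_all add: blinfun.add_right blinfun.zero_right y)
  obtain R :: nat where R: "norm y \<le> real R" using real_arch_simple by blast
  have "\<bar>sum_list (map r k) - sum_list (map r l)\<bar>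
       \<le> real R * norm (sum_list (map d k) - sum_list (map d l))" for k l
    using order_trans[OF norm_blinfun[of y "sum_list (map d k) - sum_list (map d l)"]
        mult_right_mono[OF R norm_ge_zero]]
    by (simp add: blinfun.diff_right sum)
  then show "\<exists>R::nat. \<forall>k l. \<bar>sum_list (map r k) - sum_list (map r l)\<bar>
       \<le> real R * norm (sum_list (map d k) - sum_list (map d l))" by blast
next
  assume "\<exists>R::nat. \<forall>k l. \<bar>sum_list (map r k) - sum_list (map r l)\<bar>
       \<le> real R * norm (sum_list (map d k) - sum_list (map d l))"
  then obtain R :: nat where R: "\<And>k l. \<bar>sum_list (map r k) - sum_list (map r l)\<bar>
       \<le> real R * norm (sum_list (map d k) - sum_list (map d l))" by blast
  define D where "D = range (\<lambda>l. sum_list (map d l))"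
  define \<phi> where "\<phi> e = sum_list (map r (SOME l. sum_list (map d l) = e))" for e
  have \<phi>: "\<phi> (sum_list (map d l)) = sum_list (map r l)" for l
  proof -
    have "sum_list (map d (SOME l'. sum_list (map d l') = sum_list (map d l))) = sum_list (map d l)"
      by (rule someI) simp
    then show ?thesis
      using R[of "SOME l'. sum_list (map d l') = sum_list (map d l)" l] by (simp add: \<phi>_def)
  qed
  have D_cases: "\<exists>l. e = sum_list (map d l)" if "e \<in> D" for e
  proof -
    from that[unfolded D_def] obtain l where "e = sum_list (map d l)" by (rule imageE)
    then show ?thesis by (rule exI)
  qed
  have "lipschitz_on (real R) D \<phi>"
  proof (rule lipschitz_onI)
    fix a b assume "a \<in> D" "b \<in> D"
    from D_cases[OF this(1)] obtain k where k: "a = sum_list (map d k)" by (rule exE)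
    from D_cases[OF \<open>b \<in> D\<close>] obtain l where l: "b = sum_list (map d l)" by (rule exE)
    show "dist (\<phi> a) (\<phi> b) \<le> real R * dist a b"
      unfolding k l \<phi> dist_norm real_norm_def by (rule R)
  qed simp
  then obtain g where g: "lipschitz_on (real R) (closure D) g" "\<And>x. x \<in> D \<Longrightarrow> g x = \<phi> x"
    using lipschitz_extend_closure by blast
  have "d i \<in> D" for i unfolding D_def by (rule range_eqI[of _ _ "[i]"]) simp
  then have "closure (range d) \<subseteq> closure D" by (intro closure_mono) blast
  then have clo: "closure D = UNIV" using d by auto
  have cont: "continuous_on UNIV g"
    using lipschitz_on_continuous_on[OF g(1)] clo by simp
  have gsum: "g (sum_list (map d l)) = sum_list (map r l)" for l
  proof -
    have "sum_list (map d l) \<in> D" unfolding D_def by (rule rangeI)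
    from g(2)[OF this] show ?thesis by (simp only: \<phi>)
  qed
  have "bounded_linear g"
  proof (rule lipschitz_additive_imp_linear)
    have c: "continuous_on UNIV (\<lambda>p::'e \<times> 'e. g (f p))" if "continuous_on UNIV f" for f
      by (rule continuous_on_compose2[OF cont that]) simp
    have "closed {p. g (fst p + snd p) = g (fst p) + g (snd p)}"
      by (intro closed_Collect_eq continuous_on_add c continuous_on_fst continuous_on_snd continuous_on_id)
    moreover have "D \<times> D \<subseteq> {p. g (fst p + snd p) = g (fst p) + g (snd p)}"
    proof safe
      fix a b assume "a \<in> D" "b \<in> D"
      from D_cases[OF this(1)] obtain k where k: "a = sum_list (map d k)" by (rule exE)
      from D_cases[OF \<open>b \<in> D\<close>] obtain l where l: "b = sum_list (map d l)" by (rule exE)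
      have "g (a + b) = sum_list (map r (k @ l))"
        using gsum[of "k @ l"] by (simp add: k l)
      then show "g (fst (a, b) + snd (a, b)) = g (fst (a, b)) + g (snd (a, b))"
        by (simp add: k l gsum)
    qed
    ultimately have "closure (D \<times> D) \<subseteq> {p. g (fst p + snd p) = g (fst p) + g (snd p)}"
      by (rule closure_minimal[rotated])
    then show "g (a + b) = g a + g b" for a b
      unfolding closure_Times clo by (simp add: subset_eq)
    have g0: "g 0 = 0" using gsum[of "[]"] by simp
    show "\<bar>g e\<bar> \<le> real R * norm e" for e
      using lipschitz_onD[OF g(1), of e 0] clo by (simp add: g0 dist_norm)
  qed
  then have "blinfun_apply (Blinfun g) = g" by (rule bounded_linear_Blinfun_apply)
  moreover have "g (d i) = r i" for i using gsum[of "[i]"] by simp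
  ultimately show "\<exists>y :: 'e \<Rightarrow>\<^sub>L real. \<forall>i. y (d i) = r i" by (intro exI[of _ "Blinfun g"]) simp
qed

lemma blinfun_eq_dense:
  fixes y z :: "'e::real_normed_vector \<Rightarrow>\<^sub>L real" and d :: "nat \<Rightarrow> 'e"
  assumes d: "closure (range d) = UNIV" and eq: "\<And>i. y (d i) = z (d i)"
  shows "y = z"
proof (rule blinfun_eqI)
  fix e
  obtain r where r: "(\<lambda>n. d (r n)) \<longlonglongrightarrow> e" using dense_sequence_tendsto[OF d] by blast
  have "(\<lambda>n. y (d (r n))) \<longlonglongrightarrow> y e" by (intro tendsto_intros r)
  moreover have "(\<lambda>n. z (d (r n))) \<longlonglongrightarrow> z e" by (intro tendsto_intros r)
  ultimately have "(\<lambda>n. z (d (r n))) \<longlonglongrightarrow> y e" "(\<lambda>n. z (d (r n))) \<longlonglongrightarrow> z e" by (simp_all only: eq)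
  then show "y e = z e" by (rule LIMSEQ_unique)
qed

text \<open>The sequence \<open>\<tau>\<close> codes the functional whose value at \<open>d i\<close> is the limit in \<open>n\<close> of the fractions with
denominator \<open>n + 1\<close> stored at position \<open>(i, n)\<close>; sequences that code no functional are sent to \<open>0\<close>.\<close>

lemma dual_baire_surjection:
  obtains q :: "(nat \<Rightarrow> nat) \<Rightarrow> ('e::{real_normed_vector, second_countable_topology} \<Rightarrow>\<^sub>L real)"
  where "q \<in> baire_space \<rightarrow>\<^sub>M weak_star_borel" "surj q"
proof -
  obtain d :: "nat \<Rightarrow> 'e" where d: "closure (range d) = UNIV"
    using dense_sequence_exists by blast
  define r where "r \<tau> i = lim (\<lambda>n. of_int (int_decode (\<tau> (prod_encode (i, n)))) / real (Suc n))"
    for \<tau> :: "nat \<Rightarrow> nat" and i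
  define T where "T \<tau> \<longleftrightarrow> (\<exists>y :: 'e \<Rightarrow>\<^sub>L real. \<forall>i. y (d i) = r \<tau> i)" for \<tau>
  \<comment> \<open>\<open>T \<tau>\<close> holds if the limits coded by \<open>\<tau>\<close> are the values of a functional.\<close>
  define q where "q \<tau> = (if T \<tau> then SOME y :: 'e \<Rightarrow>\<^sub>L real. \<forall>i. y (d i) = r \<tau> i else 0)" for \<tau>
  have r_meas [measurable]: "(\<lambda>\<tau>. r \<tau> i) \<in> borel_measurable baire_space" for i
  proof -
    have "(\<lambda>\<tau>. real_of_int (int_decode (\<tau> (prod_encode (i, n)))) / real (Suc n)) \<in> borel_measurable baire_space" for n
      by (rule measurable_compose[OF measurable_component_singleton[of "prod_encode (i, n)"]]) auto
    then show ?thesis unfolding r_def by (rule borel_measurable_lim_metric)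
  qed
  have sum_meas [measurable]: "(\<lambda>\<tau>. sum_list (map (r \<tau>) k)) \<in> borel_measurable baire_space" for k
    by (induction k) auto
  have T_meas [measurable]: "Measurable.pred baire_space T"
    unfolding T_def functional_from_dense_values[OF d] by measurable
  have q_d: "q \<tau> (d i) = (if T \<tau> then r \<tau> i else 0)" for \<tau> i
    unfolding q_def T_def
    using someI_ex[of "\<lambda>y :: 'e \<Rightarrow>\<^sub>L real. \<forall>i. y (d i) = r \<tau> i"] by (auto simp: blinfun.zero_left)
  show thesis
  proof
    show "q \<in> baire_space \<rightarrow>\<^sub>M weak_star_borel"
      unfolding measurable_weak_star_borel_iff
      by (rule scalarly_measurable_dense[OF d]) (simp_all add: q_d)
    have "\<exists>\<tau>. q \<tau> = y" for y
    proof -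
      define \<tau> where "\<tau> j = (case prod_decode j of (i, n) \<Rightarrow> int_encode \<lfloor>real (Suc n) * y (d i)\<rfloor>)" for j
      have "r \<tau> i = y (d i)" for i
        unfolding r_def
      proof (rule limI)
        have "norm (of_int \<lfloor>real (Suc n) * y (d i)\<rfloor> / real (Suc n) - y (d i)) \<le> inverse (real (Suc n))" for n
        proof -
          have "of_int \<lfloor>real (Suc n) * y (d i)\<rfloor> / real (Suc n) - y (d i)
            = (of_int \<lfloor>real (Suc n) * y (d i)\<rfloor> - real (Suc n) * y (d i)) / real (Suc n)"
            by (simp add: diff_divide_distrib)
          moreover have "\<bar>of_int \<lfloor>x\<rfloor> - x\<bar> \<le> 1" for x :: real by linarith
          ultimately show ?thesis
            by (simp add: inverse_eq_divide divide_right_mono del: of_nat_Suc)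
        qed
        then have "(\<lambda>n. of_int \<lfloor>real (Suc n) * y (d i)\<rfloor> / real (Suc n) - y (d i)) \<longlonglongrightarrow> 0"
          by (intro Lim_null_comparison[OF _ LIMSEQ_inverse_real_of_nat]) (auto intro: always_eventually)
        then show "(\<lambda>n. of_int (int_decode (\<tau> (prod_encode (i, n)))) / real (Suc n)) \<longlonglongrightarrow> y (d i)"
          unfolding \<tau>_def by (simp add: LIM_zero_iff del: of_nat_Suc)
      qed
      then have "T \<tau>" "\<And>i. q \<tau> (d i) = y (d i)"
        unfolding q_d by (auto simp: T_def intro!: exI[of _ y])
      then show ?thesis using blinfun_eq_dense[OF d] by blast
    qed
    then show "surj q" by (metis surjI)
  qed
qed

text \<open>Aumann's selection theorem for the weak star dual of a separable space: pull \<open>G\<close> back along the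
coding of the dual, select a code, and decode it.\<close>

proposition measurable_selection_dual:
  fixes G :: "('a \<times> ('e::{real_normed_vector, second_countable_topology} \<Rightarrow>\<^sub>L real)) set"
  assumes M: "sigma_finite_measure M" and G: "G \<in> sets (M \<Otimes>\<^sub>M weak_star_borel)"
  obtains W y where "W \<in> sets M" "scalarly_measurable M y"
    "\<And>\<omega>. \<omega> \<in> W \<Longrightarrow> (\<omega>, y \<omega>) \<in> G" "AE \<omega> in M. (\<exists>y. (\<omega>, y) \<in> G) \<longrightarrow> \<omega> \<in> W"
proof -
  obtain q :: "(nat \<Rightarrow> nat) \<Rightarrow> ('e \<Rightarrow>\<^sub>L real)"
    where q: "q \<in> baire_space \<rightarrow>\<^sub>M weak_star_borel" "surj q"
    using dual_baire_surjection by blast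
  define \<Phi> where "\<Phi> p = (fst p, q (snd p))" for p :: "'a \<times> (nat \<Rightarrow> nat)"
  have \<Phi>: "\<Phi> \<in> M \<Otimes>\<^sub>M baire_space \<rightarrow>\<^sub>M M \<Otimes>\<^sub>M weak_star_borel"
    unfolding \<Phi>_def by (intro measurable_Pair measurable_fst measurable_compose[OF measurable_snd q(1)])
  define H where "H = \<Phi> -` G \<inter> space (M \<Otimes>\<^sub>M baire_space)"
  have "H \<in> sets (M \<Otimes>\<^sub>M baire_space)"
    unfolding H_def using \<Phi> G by (rule measurable_sets)
  then obtain W \<tau> where W: "W \<in> sets M" "\<tau> \<in> M \<rightarrow>\<^sub>M baire_space"
    "\<And>\<omega>. \<omega> \<in> W \<Longrightarrow> (\<omega>, \<tau> \<omega>) \<in> H" "AE \<omega> in M. (\<exists>\<tau>. (\<omega>, \<tau>) \<in> H) \<longrightarrow> \<omega> \<in> W"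
    using measurable_selection_baire[OF M] by blast
  have mem: "(\<omega>, \<tau>) \<in> H \<longleftrightarrow> (\<omega>, q \<tau>) \<in> G" for \<omega> \<tau>
    using sets.sets_into_space[OF G] by (auto simp: H_def \<Phi>_def space_pair_measure space_PiM)
  show thesis
  proof (rule that[OF W(1)])
    show "scalarly_measurable M (\<lambda>\<omega>. q (\<tau> \<omega>))"
      using measurable_compose[OF W(2) q(1)] by (simp add: measurable_weak_star_borel_iff)
    show "(\<omega>, q (\<tau> \<omega>)) \<in> G" if "\<omega> \<in> W" for \<omega> using W(3)[OF that] mem by blast
    have "(\<exists>y. (\<omega>, y) \<in> G) \<longrightarrow> (\<exists>\<tau>. (\<omega>, \<tau>) \<in> H)" for \<omega>
      using q(2) mem by (metis surj_def)
    then show "AE \<omega> in M. (\<exists>y. (\<omega>, y) \<in> G) \<longrightarrow> \<omega> \<in> W"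
      using W(4) by (auto elim: eventually_mono)
  qed
qed

section \<open>Small pairings on weakly compact sets\<close>

text \<open>The combinatorial core of Schur's theorem. The indices \<open>r j\<close> are chosen so far apart that in row \<open>r j\<close>
the entries in the earlier chosen columns and those from column \<open>r (j + 1)\<close> on are both
negligible; the sum over the chosen columns then has about the size of the diagonal entry.\<close>

lemma gliding_hump:
  fixes a :: "nat \<Rightarrow> nat \<Rightarrow> real"
  assumes c: "c > 0" and diag: "\<And>k. c \<le> \<bar>a k k\<bar>"
    and col: "\<And>i. (\<lambda>k. a k i) \<longlonglongrightarrow> 0" and row: "\<And>k. summable (\<lambda>i. \<bar>a k i\<bar>)"
  obtains r :: "nat \<Rightarrow> nat" where "strict_mono r" "\<And>j. c / 2 \<le> \<bar>\<Sum>i. indicator (range r) i * a (r j) i\<bar>"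
proof -
  have "\<exists>q>p. (\<forall>k\<ge>q. (\<Sum>i\<le>p. \<bar>a k i\<bar>) < c / 4) \<and> (\<Sum>i. \<bar>a p (i + q)\<bar>) < c / 4" for p
  proof -
    have "(\<lambda>k. \<Sum>i\<le>p. \<bar>a k i\<bar>) \<longlonglongrightarrow> (\<Sum>i\<le>p. \<bar>0\<bar>)"
      by (intro tendsto_sum tendsto_rabs col)
    then have "\<forall>\<^sub>F k in sequentially. (\<Sum>i\<le>p. \<bar>a k i\<bar>) < c / 4"
      using c by (intro order_tendstoD) auto
    then obtain N1 where N1: "\<And>k. k \<ge> N1 \<Longrightarrow> (\<Sum>i\<le>p. \<bar>a k i\<bar>) < c / 4"
      by (auto simp: eventually_sequentially)
    obtain N2 where N2: "\<And>n. n \<ge> N2 \<Longrightarrow> norm (\<Sum>i. \<bar>a p (i + n)\<bar>) < c / 4"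
      using suminf_exist_split[OF _ row[of p], of "c / 4"] c by auto
    define q where "q = Suc p + N1 + N2"
    have "(\<Sum>i\<le>p. \<bar>a k i\<bar>) < c / 4" if "k \<ge> q" for k
      by (rule N1) (use that in \<open>simp add: q_def\<close>)
    moreover have "norm (\<Sum>i. \<bar>a p (i + q)\<bar>) < c / 4"
      by (rule N2) (simp add: q_def)
    then have "(\<Sum>i. \<bar>a p (i + q)\<bar>) < c / 4"
      unfolding real_norm_def by (rule abs_less_iff[THEN iffD1, THEN conjunct1])
    moreover have "p < q" by (simp add: q_def)
    ultimately show ?thesis by blast
  qed
  then have "\<forall>p. \<exists>q. p < q \<and> (\<forall>k\<ge>q. (\<Sum>i\<le>p. \<bar>a k i\<bar>) < c / 4) \<and>
      (\<Sum>i. \<bar>a p (i + q)\<bar>) < c / 4" by blast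
  then have "\<exists>nxt. \<forall>p. nxt p > p \<and> (\<forall>k\<ge>nxt p. (\<Sum>i\<le>p. \<bar>a k i\<bar>) < c / 4) \<and>
      (\<Sum>i. \<bar>a p (i + nxt p)\<bar>) < c / 4"
    by (rule choice)
  then obtain nxt where nxt: "\<And>p. nxt p > p" "\<And>p k. k \<ge> nxt p \<Longrightarrow> (\<Sum>i\<le>p. \<bar>a k i\<bar>) < c / 4"
    "\<And>p. (\<Sum>i. \<bar>a p (i + nxt p)\<bar>) < c / 4"
    by blast
  define r where "r = rec_nat 0 (\<lambda>_. nxt)"
  have r: "r 0 = 0" "\<And>j. r (Suc j) = nxt (r j)" by (simp_all add: r_def)
  have mono: "strict_mono r" by (simp add: strict_mono_Suc_iff r nxt)
  show thesis
  proof (rule that[OF mono])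
    fix j
    define p where "p = r j"
    define q where "q = r (Suc j)"
    have pq: "p < q" and q: "q = nxt p" by (simp_all add: p_def q_def r nxt)
    define f where "f i = indicator (range r) i * a p i" for i
    define g where "g i = (if i = p then 0 else f i)" for i
    have le: "\<bar>g i\<bar> \<le> \<bar>a p i\<bar>" for i by (simp add: g_def f_def indicator_def)
    have sum_g: "summable (\<lambda>i. \<bar>g i\<bar>)"
      by (rule summable_comparison_test'[OF row[of p], of 0]) (simp add: le)
    have "f sums (a p p + suminf g)"
    proof -
      have "(\<lambda>i. (if i = p then a p i else 0) + g i) sums (a p p + suminf g)"
        by (rule sums_add[OF sums_single summable_sums[OF summable_rabs_cancel[OF sum_g]]])
      moreover have "(\<lambda>i. (if i = p then a p i else 0) + g i) = f"
        by (auto simp: g_def f_def p_def fun_eq_iff)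
      ultimately show ?thesis by simp
    qed
    then have f: "suminf f = a p p + suminf g" by (simp add: sums_iff)
    have split: "\<bar>suminf g\<bar> \<le> (\<Sum>i. \<bar>g (i + q)\<bar>) + (\<Sum>i<q. \<bar>g i\<bar>)"
      using summable_rabs[OF sum_g] suminf_split_initial_segment[OF sum_g, of q] by linarith
    have "(\<Sum>i. \<bar>g (i + q)\<bar>) \<le> (\<Sum>i. \<bar>a p (i + q)\<bar>)"
      by (intro suminf_le le summable_ignore_initial_segment sum_g row)
    also have "\<dots> < c / 4" unfolding q by (rule nxt)
    finally have tail: "(\<Sum>i. \<bar>g (i + q)\<bar>) < c / 4" .
    have nz: "\<exists>m<j. i = r m" if i: "i < q" "g i \<noteq> 0" for i
    proof -
      have "i \<noteq> p" "i \<in> range r" using i(2) by (auto simp: g_def f_def indicator_def split: if_splits)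
      then obtain m where m: "i = r m" "m \<noteq> j" by (auto simp: p_def)
      have "m < Suc j" using i(1) unfolding m q_def by (simp only: strict_mono_less[OF mono])
      with m show ?thesis by (intro exI[of _ m]) simp
    qed
    have head: "(\<Sum>i<q. \<bar>g i\<bar>) \<le> c / 4"
    proof (cases j)
      case 0
      have "\<forall>i\<in>{..<q}. g i = 0" using nz unfolding 0 by blast
      then show ?thesis using c by simp
    next
      case (Suc j')
      have g0: "g i = 0" if "i < q" "i > r j'" for i
      proof (rule ccontr)
        assume "g i \<noteq> 0"
        from nz[OF that(1) this] obtain m where m: "m < j" "i = r m" by blast
        then have "r m \<le> r j'" unfolding strict_mono_less_eq[OF mono] Suc by (simp add: less_Suc_eq_le)
        with that(2) m(2) show False by simp
      qed
      have "r j' < q" unfolding q_def Suc by (simp add: strict_mono_less[OF mono])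
      then have "(\<Sum>i<q. \<bar>g i\<bar>) = (\<Sum>i\<le>r j'. \<bar>g i\<bar>)"
        by (intro sum.mono_neutral_right) (auto simp: not_le intro: g0)
      also have "\<dots> \<le> (\<Sum>i\<le>r j'. \<bar>a p i\<bar>)" by (intro sum_mono le)
      also have "\<dots> < c / 4" by (rule nxt) (simp add: p_def Suc r)
      finally show ?thesis by simp
    qed
    from split tail head have "\<bar>suminf g\<bar> < c / 2" by linarith
    moreover have "(\<Sum>i. indicator (range r) i * a (r j) i) = suminf f"
      unfolding f_def[abs_def] p_def ..
    ultimately show "c / 2 \<le> \<bar>\<Sum>i. indicator (range r) i * a (r j) i\<bar>"
      using diag[of p] f by linarith
  qed
qed

lemma Linf_dual_spaceI:
  fixes y :: "'a \<Rightarrow> ('e::{real_normed_vector, second_countable_topology} \<Rightarrow>\<^sub>L real)"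
  assumes "scalarly_measurable M y" "AE \<omega> in M. norm (y \<omega>) \<le> C"
  shows "y \<in> Linf_dual_space M"
  unfolding Linf_dual_space_def using assms scalarly_measurable_norm[OF assms(1)] by blast

lemma Linf_dual_space_scalarly_measurable: "y \<in> Linf_dual_space M \<Longrightarrow> scalarly_measurable M y"
  by (simp add: Linf_dual_space_def)

lemma abs_blinfun_le: "norm y \<le> C \<Longrightarrow> \<bar>blinfun_apply y e\<bar> \<le> C * norm e"
  using order_trans[OF norm_blinfun[of y e] mult_right_mono[OF _ norm_ge_zero]] by simp

lemma integrable_pairing:
  fixes y :: "'a \<Rightarrow> ('e::{banach, second_countable_topology} \<Rightarrow>\<^sub>L real)"
  assumes y: "y \<in> Linf_dual_space M" and x: "integrable M x"
  shows "integrable M (\<lambda>\<omega>. y \<omega> (x \<omega>))"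
proof -
  obtain C where C: "AE \<omega> in M. norm (y \<omega>) \<le> C" and sm: "scalarly_measurable M y"
    using y by (auto simp: Linf_dual_space_def)
  show ?thesis
  proof (rule Bochner_Integration.integrable_bound[of M "\<lambda>\<omega>. C * norm (x \<omega>)"])
    show "(\<lambda>\<omega>. y \<omega> (x \<omega>)) \<in> borel_measurable M"
      using sm x by (intro scalarly_measurable_pairing) auto
    show "AE \<omega> in M. norm (y \<omega> (x \<omega>)) \<le> norm (C * norm (x \<omega>))"
      using C by eventually_elim (auto intro: order_trans[OF abs_blinfun_le abs_ge_self])
  qed (use x in auto)
qed

lemma pairing_diff:
  fixes y z :: "'a \<Rightarrow> ('e::{banach, second_countable_topology} \<Rightarrow>\<^sub>L real)"
  assumes "y \<in> Linf_dual_space M" "z \<in> Linf_dual_space M" "integrable M x"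
  shows "pairing M (\<lambda>\<omega>. y \<omega> - z \<omega>) x = pairing M y x - pairing M z x"
  using assms unfolding pairing_def
  by (simp add: blinfun.diff_left Bochner_Integration.integral_diff integrable_pairing)

lemma continuous_map_weak_L1_pairing:
  assumes "y \<in> Linf_dual_space M"
  shows "continuous_map (weak_L1_topology M) euclideanreal (pairing M y)"
proof -
  have "continuous_map (product_topology (\<lambda>_. euclideanreal) (Linf_dual_space M)) euclideanreal (\<lambda>f. f y)"
    using assms by (rule continuous_map_product_projection)
  then have "continuous_map (weak_L1_topology M) euclideanreal
      ((\<lambda>f. f y) \<circ> (\<lambda>x. \<lambda>y\<in>Linf_dual_space M. pairing M y x))"
    unfolding weak_L1_topology_def by (rule continuous_map_pullback)
  then show ?thesis using assms by (simp add: comp_def)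
qed

lemma weakly_compact_subset_L1:
  "compactin (weak_L1_topology M) K \<Longrightarrow> x \<in> K \<Longrightarrow> integrable M x"
  using compactin_subset_topspace[of "weak_L1_topology M" K]
  by (auto simp: weak_L1_topology_def topspace_pullback_topology L1_space_def)

text \<open>Weak compactness alone does not give convergent subsequences, but it does for countably many
functionals at a time: the image of \<open>K\<close> in the metrizable space of real sequences is compact.\<close>

lemma weakly_compact_convergent_subsequence:
  assumes K: "compactin (weak_L1_topology M) K" and x: "\<And>n::nat. x n \<in> K"
    and y: "\<And>i::nat. y i \<in> Linf_dual_space M"
  obtains x' and q :: "nat \<Rightarrow> nat" where "x' \<in> K" "strict_mono q"
    "\<And>i. (\<lambda>n. pairing M (y i) (x (q n))) \<longlonglongrightarrow> pairing M (y i) x'"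
proof -
  define F where "F z = (\<lambda>i. pairing M (y i) z)" for z
  have "continuous_map (weak_L1_topology M) (product_topology (\<lambda>i. euclideanreal) UNIV) F"
    unfolding continuous_map_componentwise_UNIV F_def
    by (intro allI continuous_map_weak_L1_pairing y)
  from image_compactin[OF K this] have "compact (F ` K)"
    by (simp add: euclidean_product_topology)
  then have "seq_compact (F ` K)" by (rule compact_imp_seq_compact)
  moreover have "\<forall>n. F (x n) \<in> F ` K" using x by blast
  ultimately obtain l q where l: "l \<in> F ` K" and q: "strict_mono q" "((\<lambda>n. F (x n)) \<circ> q) \<longlonglongrightarrow> l"
    by (rule seq_compactE)
  from l obtain x' where x': "x' \<in> K" "l = F x'" by blast
  show thesis
  proof (rule that[OF x'(1) q(1)])
    fix i
    have "continuous_on UNIV (\<lambda>f :: nat \<Rightarrow> real. f i)" by (rule continuous_on_product_coordinates)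
    from continuous_on_tendsto_compose[OF this q(2)]
    show "(\<lambda>n. pairing M (y i) (x (q n))) \<longlonglongrightarrow> pairing M (y i) x'"
      by (simp add: x'(2) F_def)
  qed
qed

text \<open>Since the norms are summable with a uniform bound, every subseries of \<open>\<xi>\<close> is again a function in
\<open>L\<^sub>\<infinity>\<close>; therefore \<open>x \<mapsto> (pairing M (\<xi> k) x)\<^sub>k\<close> maps into \<open>\<ell>\<^sub>1\<close> and is continuous for the weak topologies
as far as indicator functions of index sets can tell.\<close>

locale bounded_series =
  fixes M :: "'a measure"
    and \<xi> :: "nat \<Rightarrow> 'a \<Rightarrow> ('e::{banach, second_countable_topology} \<Rightarrow>\<^sub>L real)" and C :: real
  assumes meas: "\<And>k. scalarly_measurable M (\<xi> k)"
    and bound: "\<And>n \<omega>. \<omega> \<in> space M \<Longrightarrow> (\<Sum>k<n. norm (\<xi> k \<omega>)) \<le> C"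
begin

definition subseries :: "nat set \<Rightarrow> 'a \<Rightarrow> ('e \<Rightarrow>\<^sub>L real)" where
  "subseries s \<omega> = (\<Sum>k. indicator s k *\<^sub>R \<xi> k \<omega>)"

lemma norm_le: "\<omega> \<in> space M \<Longrightarrow> norm (\<xi> k \<omega>) \<le> C"
  by (rule order_trans[OF _ bound[of \<omega> "Suc k"]])
    (simp_all add: sum_nonneg)

lemma in_Linf: "\<xi> k \<in> Linf_dual_space M"
  by (rule Linf_dual_spaceI[OF meas, of _ C]) (auto intro: norm_le)

lemma summable_norm: "\<omega> \<in> space M \<Longrightarrow> summable (\<lambda>k. norm (\<xi> k \<omega>))"
  by (rule bounded_imp_summable[of _ C])
    (simp_all only: lessThan_Suc_atMost[symmetric] bound norm_ge_zero)

lemma summable_norm_indicator: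
  "\<omega> \<in> space M \<Longrightarrow> summable (\<lambda>k. norm (indicator s k *\<^sub>R \<xi> k \<omega>))"
  by (rule summable_comparison_test'[OF summable_norm, of _ 0]) (auto simp: indicator_def)

lemma subseries_apply:
  assumes "\<omega> \<in> space M"
  shows "subseries s \<omega> e = (\<Sum>k. indicator s k * \<xi> k \<omega> e)"
  unfolding subseries_def
  using bounded_linear.suminf[OF blinfun.bounded_linear_left[of e]
      summable_norm_cancel[OF summable_norm_indicator[OF assms, of s]]]
  by (simp add: blinfun.scaleR_left)

lemma subseries_in_Linf: "subseries s \<in> Linf_dual_space M"
proof (rule Linf_dual_spaceI)
  have "(\<lambda>\<omega>. \<Sum>k. indicator s k * \<xi> k \<omega> e) \<in> borel_measurable M" for e
    using meas by (intro borel_measurable_suminf borel_measurable_times borel_measurable_const)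
      (simp add: scalarly_measurable_def)
  then show "scalarly_measurable M (subseries s)"
    unfolding scalarly_measurable_def by (simp add: subseries_apply cong: measurable_cong)
  show "AE \<omega> in M. norm (subseries s \<omega>) \<le> C"
  proof (rule AE_I2)
    fix \<omega> assume \<omega>: "\<omega> \<in> space M"
    have "norm (subseries s \<omega>) \<le> (\<Sum>k. norm (indicator s k *\<^sub>R \<xi> k \<omega>))"
      unfolding subseries_def by (rule Series.summable_norm[OF summable_norm_indicator[OF \<omega>]])
    also have "\<dots> \<le> (\<Sum>k. norm (\<xi> k \<omega>))"
      by (intro suminf_le summable_norm summable_norm_indicator \<omega>) (auto simp: indicator_def)
    also have "\<dots> \<le> C"
      by (rule suminf_le_const[OF summable_norm[OF \<omega>]]) (rule bound[OF \<omega>])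
    finally show "norm (subseries s \<omega>) \<le> C" .
  qed
qed

lemma summable_integral_abs:
  assumes x: "integrable M x"
  shows "summable (\<lambda>k. \<integral>\<omega>. \<bar>\<xi> k \<omega> (x \<omega>)\<bar> \<partial>M)"
proof (rule bounded_imp_summable[of _ "\<integral>\<omega>. C * norm (x \<omega>) \<partial>M"])
  fix n
  have int: "integrable M (\<lambda>\<omega>. \<bar>\<xi> k \<omega> (x \<omega>)\<bar>)" for k
    by (intro integrable_abs integrable_pairing in_Linf x)
  have "(\<Sum>k\<le>n. \<integral>\<omega>. \<bar>\<xi> k \<omega> (x \<omega>)\<bar> \<partial>M) = (\<integral>\<omega>. (\<Sum>k\<le>n. \<bar>\<xi> k \<omega> (x \<omega>)\<bar>) \<partial>M)"
    by (rule Bochner_Integration.integral_sum[symmetric]) (rule int)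
  also have "\<dots> \<le> (\<integral>\<omega>. C * norm (x \<omega>) \<partial>M)"
  proof (rule integral_mono)
    fix \<omega> assume \<omega>: "\<omega> \<in> space M"
    have "(\<Sum>k\<le>n. \<bar>\<xi> k \<omega> (x \<omega>)\<bar>) \<le> (\<Sum>k<Suc n. norm (\<xi> k \<omega>) * norm (x \<omega>))"
      unfolding lessThan_Suc_atMost by (intro sum_mono abs_blinfun_le order_refl)
    also have "\<dots> \<le> C * norm (x \<omega>)"
      unfolding sum_distrib_right[symmetric] by (intro mult_right_mono bound \<omega>) simp
    finally show "(\<Sum>k\<le>n. \<bar>\<xi> k \<omega> (x \<omega>)\<bar>) \<le> C * norm (x \<omega>)" .
  qed (use x int in auto)
  finally show "(\<Sum>k\<le>n. \<integral>\<omega>. \<bar>\<xi> k \<omega> (x \<omega>)\<bar> \<partial>M) \<le> (\<integral>\<omega>. C * norm (x \<omega>) \<partial>M)" .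
qed simp

lemma summable_pairing:
  assumes x: "integrable M x"
  shows "summable (\<lambda>k. \<bar>pairing M (\<xi> k) x\<bar>)"
  by (rule summable_comparison_test'[OF summable_integral_abs[OF x], of 0])
    (simp add: pairing_def integral_abs_bound)

lemma pairing_subseries:
  assumes x: "integrable M x"
  shows "pairing M (subseries s) x = (\<Sum>k. indicator s k * pairing M (\<xi> k) x)"
proof -
  have int: "integrable M (\<lambda>\<omega>. \<xi> k \<omega> (x \<omega>))" for k by (intro integrable_pairing in_Linf x)
  have "pairing M (subseries s) x = (\<integral>\<omega>. (\<Sum>k. indicator s k * \<xi> k \<omega> (x \<omega>)) \<partial>M)"
    unfolding pairing_def by (intro Bochner_Integration.integral_cong refl subseries_apply)
  also have "\<dots> = (\<Sum>k. \<integral>\<omega>. indicator s k * \<xi> k \<omega> (x \<omega>) \<partial>M)"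
  proof (rule integral_suminf)
    show "AE \<omega> in M. summable (\<lambda>k. norm (indicator s k * \<xi> k \<omega> (x \<omega>)))"
    proof (rule AE_I2)
      fix \<omega> assume "\<omega> \<in> space M"
      then have "summable (\<lambda>k. norm (\<xi> k \<omega>) * norm (x \<omega>))"
        by (intro summable_mult2 summable_norm)
      then show "summable (\<lambda>k. norm (indicator s k * \<xi> k \<omega> (x \<omega>)))"
        by (rule summable_comparison_test'[of _ 0])
          (auto simp: indicator_def abs_blinfun_le)
    qed
    show "summable (\<lambda>k. \<integral>\<omega>. norm (indicator s k * \<xi> k \<omega> (x \<omega>)) \<partial>M)"
      by (rule summable_comparison_test'[OF summable_integral_abs[OF x], of 0])
        (auto simp: indicator_def)
  qed (use int in simp)
  also have "\<dots> = (\<Sum>k. indicator s k * pairing M (\<xi> k) x)"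
    unfolding pairing_def by simp
  finally show ?thesis .
qed

text \<open>The gliding hump selects an index set \<open>s\<close> such that the subseries over \<open>s\<close> keeps \<open>h (r j)\<close> away from
\<open>x\<close>. But a weak cluster point of \<open>h (r j)\<close> has the same coordinates as \<open>x\<close>, hence the same pairing
with that subseries.\<close>

lemma pairing_convergent_diagonal:
  assumes K: "compactin (weak_L1_topology M) K" and h: "\<And>k::nat. h k \<in> K" and x: "x \<in> K" and c: "c > 0"
    and lim: "\<And>i. (\<lambda>k. pairing M (\<xi> i) (h k)) \<longlonglongrightarrow> pairing M (\<xi> i) x"
    and diag: "\<And>k. c \<le> \<bar>pairing M (\<xi> k) (h k) - pairing M (\<xi> k) x\<bar>"
  shows False
proof -
  note int = weakly_compact_subset_L1[OF K]
  define a where "a k i = pairing M (\<xi> i) (h k) - pairing M (\<xi> i) x" for k i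
  have row: "summable (\<lambda>i. \<bar>a k i\<bar>)" for k
  proof (rule summable_comparison_test'[of _ 0])
    show "summable (\<lambda>i. \<bar>pairing M (\<xi> i) (h k)\<bar> + \<bar>pairing M (\<xi> i) x\<bar>)"
      by (intro summable_add summable_pairing int h x)
  qed (simp add: a_def abs_triangle_ineq4)
  obtain r :: "nat \<Rightarrow> nat" where r: "strict_mono r" "\<And>j. c / 2 \<le> \<bar>\<Sum>i. indicator (range r) i * a (r j) i\<bar>"
  proof (rule gliding_hump[of c a])
    show "(\<lambda>k. a k i) \<longlonglongrightarrow> 0" for i
      using lim[of i] by (simp add: a_def LIM_zero_iff)
  qed (use c diag row in \<open>auto simp: a_def\<close>)
  define s where "s = range r"
  have sum_ind: "summable (\<lambda>i. indicator s i * pairing M (\<xi> i) z)" if "z \<in> K" for z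
    by (rule summable_rabs_cancel, rule summable_comparison_test'[OF summable_pairing[OF int[OF that]], of 0])
       (auto simp: indicator_def)
  have eq: "(\<Sum>i. indicator s i * a k i) = pairing M (subseries s) (h k) - pairing M (subseries s) x" for k
    unfolding pairing_subseries[OF int[OF h]] pairing_subseries[OF int[OF x]]
    by (subst suminf_diff[OF sum_ind[OF h] sum_ind[OF x]]) (simp add: a_def right_diff_distrib)
  obtain x' and q :: "nat \<Rightarrow> nat" where x': "x' \<in> K" "strict_mono q" and
    lim': "\<And>i. (\<lambda>n. pairing M (case_nat (subseries s) \<xi> i) (h (r (q n))))
       \<longlonglongrightarrow> pairing M (case_nat (subseries s) \<xi> i) x'"
  proof (rule weakly_compact_convergent_subsequence[OF K, of "\<lambda>n. h (r n)" "case_nat (subseries s) \<xi>"])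
    show "case_nat (subseries s) \<xi> i \<in> Linf_dual_space M" for i
      by (cases i) (simp_all add: subseries_in_Linf in_Linf)
  qed (use h in auto)
  have same: "pairing M (\<xi> i) x' = pairing M (\<xi> i) x" for i
  proof (rule LIMSEQ_unique)
    show "(\<lambda>n. pairing M (\<xi> i) (h (r (q n)))) \<longlonglongrightarrow> pairing M (\<xi> i) x'"
      using lim'[of "Suc i"] by simp
    show "(\<lambda>n. pairing M (\<xi> i) (h (r (q n)))) \<longlonglongrightarrow> pairing M (\<xi> i) x"
      using LIMSEQ_subseq_LIMSEQ[OF lim strict_mono_o[OF r(1) x'(2)]] by (simp add: comp_def)
  qed
  have "pairing M (subseries s) x' = pairing M (subseries s) x"
    unfolding pairing_subseries[OF int[OF x'(1)]] pairing_subseries[OF int[OF x]] same ..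
  then have "(\<lambda>n. pairing M (subseries s) (h (r (q n)))) \<longlonglongrightarrow> pairing M (subseries s) x"
    using lim'[of 0] by simp
  then have "(\<lambda>n. \<bar>\<Sum>i. indicator s i * a (r (q n)) i\<bar>) \<longlonglongrightarrow> 0"
    unfolding eq by (intro tendsto_rabs_zero) (simp add: LIM_zero_iff)
  then have "c / 2 \<le> 0"
    by (rule LIMSEQ_le_const) (use r(2) in \<open>auto simp: s_def\<close>)
  then show False using c by simp
qed

end

lemma bounded_series_subseq:
  assumes "bounded_series M \<xi> C" "strict_mono r"
  shows "bounded_series M (\<lambda>k. \<xi> (r k)) C"
proof -
  interpret bounded_series M \<xi> C by fact
  show ?thesis
  proof
    show "scalarly_measurable M (\<xi> (r k))" for k by (rule meas)
    fix n \<omega> assume \<omega>: "\<omega> \<in> space M"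
    have "(\<Sum>k<n. norm (\<xi> (r k) \<omega>)) = (\<Sum>k\<in>r ` {..<n}. norm (\<xi> k \<omega>))"
      using strict_mono_imp_inj_on[OF assms(2)] by (subst sum.reindex) (auto simp: inj_on_def)
    also have "\<dots> \<le> (\<Sum>k<r n. norm (\<xi> k \<omega>))"
      using strict_mono_less[OF assms(2)] by (intro sum_mono2) auto
    also have "\<dots> \<le> C" by (rule bound[OF \<omega>])
    finally show "(\<Sum>k<n. norm (\<xi> (r k) \<omega>)) \<le> C" .
  qed
qed

lemma bounded_series_pairing_tendsto_0:
  assumes \<xi>: "bounded_series M \<xi> C" and K: "compactin (weak_L1_topology M) K" and h: "\<And>k::nat. h k \<in> K"
  shows "(\<lambda>k. pairing M (\<xi> k) (h k)) \<longlonglongrightarrow> 0"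
proof (rule ccontr)
  interpret bounded_series M \<xi> C by fact
  assume "\<not> (\<lambda>k. pairing M (\<xi> k) (h k)) \<longlonglongrightarrow> 0"
  then have "\<exists>c>0. \<forall>N. \<exists>k\<ge>N. c \<le> \<bar>pairing M (\<xi> k) (h k)\<bar>"
    unfolding LIMSEQ_iff by (simp add: not_less)
  then obtain c where c: "c > 0" "\<And>N. \<exists>k\<ge>N. c \<le> \<bar>pairing M (\<xi> k) (h k)\<bar>" by blast
  have "infinite {k. c \<le> \<bar>pairing M (\<xi> k) (h k)\<bar>}"
    unfolding infinite_nat_iff_unbounded_le mem_Collect_eq using c(2) by blast
  then obtain r :: "nat \<Rightarrow> nat" where r: "strict_mono r" "\<And>n. c \<le> \<bar>pairing M (\<xi> (r n)) (h (r n))\<bar>"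
    using infinite_enumerate by blast
  obtain x and q :: "nat \<Rightarrow> nat" where x: "x \<in> K" "strict_mono q" and
    lim: "\<And>i. (\<lambda>n. pairing M (\<xi> i) (h (r (q n)))) \<longlonglongrightarrow> pairing M (\<xi> i) x"
    using weakly_compact_convergent_subsequence[OF K, of "\<lambda>n. h (r n)" \<xi>] h in_Linf by blast
  have "(\<lambda>i. \<bar>pairing M (\<xi> i) x\<bar>) \<longlonglongrightarrow> 0"
    by (rule summable_LIMSEQ_zero[OF summable_pairing[OF weakly_compact_subset_L1[OF K x(1)]]])
  then have "\<forall>\<^sub>F i in sequentially. \<bar>pairing M (\<xi> i) x\<bar> < c / 2"
    using c(1) by (intro order_tendstoD) auto
  then obtain N where N: "\<And>i. i \<ge> N \<Longrightarrow> \<bar>pairing M (\<xi> i) x\<bar> < c / 2"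
    by (auto simp: eventually_sequentially)
  \<comment> \<open>Along \<open>t\<close>, the absolute value of the diagonal pairings with \<open>h\<close> is at least \<open>c\<close>, and that of the
      pairings with the limit \<open>x\<close> is below \<open>c / 2\<close>.\<close>
  define t where "t k = r (q (k + N))" for k
  have t: "strict_mono t"
    using strict_mono_less[OF r(1)] strict_mono_less[OF x(2)] by (auto simp: t_def strict_mono_def)
  interpret T: bounded_series M "\<lambda>k. \<xi> (t k)" C
    by (rule bounded_series_subseq[OF \<xi> t])
  show False
  proof (rule T.pairing_convergent_diagonal[OF K _ x(1), of "\<lambda>k. h (t k)" "c / 2"])
    show "(\<lambda>k. pairing M (\<xi> (t i)) (h (t k))) \<longlonglongrightarrow> pairing M (\<xi> (t i)) x" for i
      unfolding t_def using LIMSEQ_ignore_initial_segment[OF lim, of "t i" N] by (simp add: t_def)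
    show "c / 2 \<le> \<bar>pairing M (\<xi> (t k)) (h (t k)) - pairing M (\<xi> (t k)) x\<bar>" for k
    proof -
      have "k + N \<le> r (q (k + N))"
        using strict_mono_imp_increasing[OF r(1)] strict_mono_imp_increasing[OF x(2)] order_trans by blast
      then have "\<bar>pairing M (\<xi> (t k)) x\<bar> < c / 2" unfolding t_def by (intro N) simp
      then show ?thesis
        using r(2)[of "q (k + N)"] abs_triangle_ineq2[of "pairing M (\<xi> (t k)) (h (t k))" "pairing M (\<xi> (t k)) x"]
        unfolding t_def by linarith
    qed
  qed (use h c in auto)
qed

lemma abs_pairing_le_integral:
  fixes y :: "'a \<Rightarrow> ('e::{banach, second_countable_topology} \<Rightarrow>\<^sub>L real)"
  assumes y: "y \<in> Linf_dual_space M" and x: "integrable M x"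
    and \<theta>: "integrable M (\<lambda>\<omega>. \<theta> \<omega> * norm (x \<omega>))" and le: "\<And>\<omega>. \<omega> \<in> space M \<Longrightarrow> norm (y \<omega>) \<le> \<theta> \<omega>"
  shows "\<bar>pairing M y x\<bar> \<le> (\<integral>\<omega>. \<theta> \<omega> * norm (x \<omega>) \<partial>M)"
proof -
  have "\<bar>pairing M y x\<bar> \<le> (\<integral>\<omega>. \<bar>y \<omega> (x \<omega>)\<bar> \<partial>M)"
    unfolding pairing_def by (rule integral_abs_bound)
  also have "\<dots> \<le> (\<integral>\<omega>. \<theta> \<omega> * norm (x \<omega>) \<partial>M)"
    by (intro integral_mono integrable_abs integrable_pairing y x \<theta> abs_blinfun_le le)
  finally show ?thesis .
qed

text \<open>Let \<open>\<theta> n = sup\<^sub>m\<^sub>\<ge>\<^sub>n \<parallel>w m\<parallel>\<close>, which decreases to \<open>0\<close> almost everywhere. Along a sufficiently sparse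
subsequence \<open>r\<close>, replacing \<open>w (r k)\<close> by \<open>\<xi> k = (1 - \<theta> (r (k + 1)) / \<theta> (r k)) w (r k)\<close> hardly changes its
pairing with \<open>h (r k)\<close>, while \<open>\<parallel>\<xi> k\<parallel> \<le> \<theta> (r k) - \<theta> (r (k + 1))\<close> telescopes. Thus \<open>\<xi>\<close> is a bounded
series, and its diagonal pairings tend to \<open>0\<close>. The multiples of \<open>w\<close> itself thus
serve as test functions.\<close>

lemma bounded_null_sequence_pairing_small:
  fixes w :: "nat \<Rightarrow> 'a \<Rightarrow> ('e::{banach, second_countable_topology} \<Rightarrow>\<^sub>L real)"
  assumes K: "compactin (weak_L1_topology M) K" and h: "\<And>n. h n \<in> K" and \<epsilon>: "\<epsilon> > 0"
    and meas: "\<And>n. scalarly_measurable M (w n)"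
    and bound: "\<And>n \<omega>. \<omega> \<in> space M \<Longrightarrow> norm (w n \<omega>) \<le> C"
    and lim: "AE \<omega> in M. (\<lambda>n. norm (w n \<omega>)) \<longlonglongrightarrow> 0"
  shows "\<exists>n. \<bar>pairing M (w n) (h n)\<bar> < \<epsilon>"
proof (rule ccontr)
  assume "\<nexists>n. \<bar>pairing M (w n) (h n)\<bar> < \<epsilon>"
  then have big: "\<epsilon> \<le> \<bar>pairing M (w n) (h n)\<bar>" for n by (simp add: not_less)
  have int: "integrable M (h n)" for n by (rule weakly_compact_subset_L1[OF K h])
  define \<theta> where "\<theta> n \<omega> = (SUP m\<in>{n..}. norm (w m \<omega>))" for n \<omega>
  have bdd: "bdd_above ((\<lambda>m. norm (w m \<omega>)) ` {n..})" if "\<omega> \<in> space M" for n \<omega>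
    using bound[OF that] by (intro bdd_aboveI[of _ C]) auto
  have \<theta>_ge: "norm (w m \<omega>) \<le> \<theta> n \<omega>" if "\<omega> \<in> space M" "n \<le> m" for n m \<omega>
    unfolding \<theta>_def using that by (intro cSUP_upper bdd) auto
  have \<theta>_le: "\<theta> n \<omega> \<le> D" if "\<And>m. m \<ge> n \<Longrightarrow> norm (w m \<omega>) \<le> D" for n \<omega> D
    unfolding \<theta>_def using that by (intro cSUP_least) auto
  have \<theta>_anti: "\<theta> m \<omega> \<le> \<theta> n \<omega>" if "\<omega> \<in> space M" "n \<le> m" for n m \<omega>
    using that by (intro \<theta>_le \<theta>_ge) auto
  have \<theta>_C: "\<theta> n \<omega> \<le> C" if "\<omega> \<in> space M" for n \<omega> by (intro \<theta>_le bound that)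
  have \<theta>_pos: "0 \<le> \<theta> n \<omega>" if "\<omega> \<in> space M" for n \<omega>
    using order_trans[OF norm_ge_zero \<theta>_ge[OF that order_refl]] .
  have \<theta>_meas: "\<theta> n \<in> borel_measurable M" for n
    unfolding \<theta>_def[abs_def]
    by (rule borel_measurable_cSUP) (use scalarly_measurable_norm[OF meas] bdd in auto)
  have \<theta>_lim: "AE \<omega> in M. (\<lambda>n. \<theta> n \<omega>) \<longlonglongrightarrow> 0"
    using lim AE_space
  proof eventually_elim
    fix \<omega> assume \<omega>: "(\<lambda>n. norm (w n \<omega>)) \<longlonglongrightarrow> 0" "\<omega> \<in> space M"
    show "(\<lambda>n. \<theta> n \<omega>) \<longlonglongrightarrow> 0"
    proof (rule LIMSEQ_I)
      fix e :: real assume "e > 0"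
      then obtain N where N: "\<And>m. m \<ge> N \<Longrightarrow> norm (w m \<omega>) < e / 2"
        using LIMSEQ_D[OF \<omega>(1), of "e / 2"] by auto
      have "norm (\<theta> n \<omega> - 0) < e" if "n \<ge> N" for n
      proof -
        have "\<theta> n \<omega> \<le> e / 2" by (rule \<theta>_le) (use N that in \<open>auto intro: less_imp_le\<close>)
        with \<theta>_pos[OF \<omega>(2), of n] \<open>e > 0\<close> show ?thesis by simp
      qed
      then show "\<exists>N. \<forall>n\<ge>N. norm (\<theta> n \<omega> - 0) < e" by blast
    qed
  qed
  have \<theta>_int: "integrable M (\<lambda>\<omega>. \<theta> m \<omega> * norm (h n \<omega>))" for m n
  proof (rule Bochner_Integration.integrable_bound[of M "\<lambda>\<omega>. C * norm (h n \<omega>)"])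
    show "(\<lambda>\<omega>. \<theta> m \<omega> * norm (h n \<omega>)) \<in> borel_measurable M"
      using \<theta>_meas int[of n] by (intro borel_measurable_times borel_measurable_norm) auto
    show "AE \<omega> in M. norm (\<theta> m \<omega> * norm (h n \<omega>)) \<le> norm (C * norm (h n \<omega>))"
      using \<theta>_pos \<theta>_C by (intro AE_I2) (auto simp: abs_mult intro!: mult_right_mono order_trans[OF _ abs_ge_self])
  qed (use int[of n] in auto)
  have "\<exists>m>n. (\<integral>\<omega>. \<theta> m \<omega> * norm (h n \<omega>) \<partial>M) < \<epsilon> / 2" for n
  proof -
    have "(\<lambda>m. \<integral>\<omega>. \<theta> m \<omega> * norm (h n \<omega>) \<partial>M) \<longlonglongrightarrow> (\<integral>\<omega>. 0 \<partial>M)"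
    proof (rule integral_dominated_convergence[of _ _ _ "\<lambda>\<omega>. C * norm (h n \<omega>)"])
      show "AE \<omega> in M. (\<lambda>m. \<theta> m \<omega> * norm (h n \<omega>)) \<longlonglongrightarrow> 0"
        using \<theta>_lim by eventually_elim (rule tendsto_mult_left_zero)
      show "AE \<omega> in M. norm (\<theta> m \<omega> * norm (h n \<omega>)) \<le> C * norm (h n \<omega>)" for m
        using \<theta>_pos \<theta>_C by (intro AE_I2) (auto simp: abs_mult intro!: mult_right_mono)
    qed (use \<theta>_int int[of n] in auto)
    then have "\<forall>\<^sub>F m in sequentially. (\<integral>\<omega>. \<theta> m \<omega> * norm (h n \<omega>) \<partial>M) < \<epsilon> / 2"
      using \<epsilon> by (intro order_tendstoD) auto
    then obtain N where "\<And>m. m \<ge> N \<Longrightarrow> (\<integral>\<omega>. \<theta> m \<omega> * norm (h n \<omega>) \<partial>M) < \<epsilon> / 2"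
      unfolding eventually_sequentially by blast
    then show ?thesis by (intro exI[of _ "Suc n + N"]) simp
  qed
  then have "\<forall>n. \<exists>m. n < m \<and> (\<integral>\<omega>. \<theta> m \<omega> * norm (h n \<omega>) \<partial>M) < \<epsilon> / 2" by blast
  then have "\<exists>nxt. \<forall>n. n < nxt n \<and> (\<integral>\<omega>. \<theta> (nxt n) \<omega> * norm (h n \<omega>) \<partial>M) < \<epsilon> / 2" by (rule choice)
  then obtain nxt where nxt: "\<And>n. n < nxt n"
    "\<And>n. (\<integral>\<omega>. \<theta> (nxt n) \<omega> * norm (h n \<omega>) \<partial>M) < \<epsilon> / 2" by blast
  define r where "r = rec_nat 0 (\<lambda>_. nxt)"
  have r: "r (Suc j) = nxt (r j)" for j by (simp add: r_def)
  have r_le: "r j \<le> r (Suc j)" for j using nxt(1)[of "r j"] by (simp add: r)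
  define \<eta> where "\<eta> k \<omega> = (\<theta> (r (Suc k)) \<omega> / \<theta> (r k) \<omega>) *\<^sub>R w (r k) \<omega>" for k \<omega>
  define \<xi> where "\<xi> k \<omega> = w (r k) \<omega> - \<eta> k \<omega>" for k \<omega>
  have \<eta>_meas: "scalarly_measurable M (\<eta> k)" for k
    unfolding \<eta>_def[abs_def] using \<theta>_meas meas
    by (intro scalarly_measurable_scaleR borel_measurable_divide)
  have \<eta>_norm: "norm (\<eta> k \<omega>) \<le> \<theta> (r (Suc k)) \<omega>"
    and \<xi>_norm: "norm (\<xi> k \<omega>) \<le> \<theta> (r k) \<omega> - \<theta> (r (Suc k)) \<omega>" if \<omega>: "\<omega> \<in> space M" for k \<omega>
  proof -
    \<comment> \<open>If \<open>\<theta> (r k) \<omega> = 0\<close>, the quotient is \<open>0\<close> by convention and \<open>w (r k) \<omega> = 0\<close>, so both bounds still hold.\<close>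
    define a where "a = \<theta> (r k) \<omega>"
    define b where "b = \<theta> (r (Suc k)) \<omega>"
    have ab: "0 \<le> b" "b \<le> a" "norm (w (r k) \<omega>) \<le> a"
      unfolding a_def b_def using \<omega> r_le by (auto intro: \<theta>_pos \<theta>_anti \<theta>_ge)
    have *: "norm (\<eta> k \<omega>) = b / a * norm (w (r k) \<omega>)"
      "norm (\<xi> k \<omega>) = (1 - b / a) * norm (w (r k) \<omega>)"
    proof -
      have "\<xi> k \<omega> = (1 - b / a) *\<^sub>R w (r k) \<omega>"
        by (simp add: \<xi>_def \<eta>_def a_def b_def scaleR_left_diff_distrib)
      then show "norm (\<xi> k \<omega>) = (1 - b / a) * norm (w (r k) \<omega>)"
        using ab by (cases "a = 0") (simp_all add: divide_le_eq_1)
      show "norm (\<eta> k \<omega>) = b / a * norm (w (r k) \<omega>)"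
        using ab by (simp add: \<eta>_def a_def[symmetric] b_def[symmetric])
    qed
    show "norm (\<eta> k \<omega>) \<le> \<theta> (r (Suc k)) \<omega>" "norm (\<xi> k \<omega>) \<le> \<theta> (r k) \<omega> - \<theta> (r (Suc k)) \<omega>"
    proof -
      have "b / a * norm (w (r k) \<omega>) \<le> b / a * a" using ab by (intro mult_left_mono) auto
      then show "norm (\<eta> k \<omega>) \<le> \<theta> (r (Suc k)) \<omega>"
        unfolding * b_def[symmetric] using ab by (cases "a = 0") auto
      have "(1 - b / a) * norm (w (r k) \<omega>) \<le> (1 - b / a) * a"
        using ab by (intro mult_left_mono) (auto simp: divide_le_eq_1)
      then show "norm (\<xi> k \<omega>) \<le> \<theta> (r k) \<omega> - \<theta> (r (Suc k)) \<omega>"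
        unfolding * a_def[symmetric] b_def[symmetric] using ab by (cases "a = 0") (auto simp: left_diff_distrib)
    qed
  qed
  have "bounded_series M \<xi> C"
  proof
    show "scalarly_measurable M (\<xi> k)" for k
      unfolding \<xi>_def[abs_def] by (intro scalarly_measurable_diff meas \<eta>_meas)
    fix n \<omega> assume \<omega>: "\<omega> \<in> space M"
    have "(\<Sum>k<n. norm (\<xi> k \<omega>)) \<le> (\<Sum>k<n. \<theta> (r k) \<omega> - \<theta> (r (Suc k)) \<omega>)"
      by (intro sum_mono \<xi>_norm \<omega>)
    also have "\<dots> = \<theta> (r 0) \<omega> - \<theta> (r n) \<omega>" by (rule sum_lessThan_telescope')
    also have "\<dots> \<le> C" using \<theta>_pos[OF \<omega>, of "r n"] \<theta>_C[OF \<omega>, of "r 0"] by linarith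
    finally show "(\<Sum>k<n. norm (\<xi> k \<omega>)) \<le> C" .
  qed
  from bounded_series_pairing_tendsto_0[OF this K, of "\<lambda>k. h (r k)"]
  have "(\<lambda>k. \<bar>pairing M (\<xi> k) (h (r k))\<bar>) \<longlonglongrightarrow> 0"
    using h by (intro tendsto_rabs_zero) auto
  moreover have "\<epsilon> / 2 \<le> \<bar>pairing M (\<xi> k) (h (r k))\<bar>" for k
  proof -
    have w_Linf: "w (r k) \<in> Linf_dual_space M"
      using meas bound by (intro Linf_dual_spaceI[of _ _ C] AE_I2)
    have \<eta>_Linf: "\<eta> k \<in> Linf_dual_space M"
      by (rule Linf_dual_spaceI[OF \<eta>_meas, of _ C], rule AE_I2)
         (rule order_trans[OF \<eta>_norm \<theta>_C])
    have "pairing M (\<xi> k) (h (r k)) = pairing M (w (r k)) (h (r k)) - pairing M (\<eta> k) (h (r k))"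
      unfolding \<xi>_def[abs_def] by (rule pairing_diff[OF w_Linf \<eta>_Linf int])
    moreover have "\<bar>pairing M (\<eta> k) (h (r k))\<bar> \<le> (\<integral>\<omega>. \<theta> (r (Suc k)) \<omega> * norm (h (r k) \<omega>) \<partial>M)"
      by (rule abs_pairing_le_integral[OF \<eta>_Linf int \<theta>_int \<eta>_norm])
    moreover have "\<dots> < \<epsilon> / 2" unfolding r by (rule nxt)
    ultimately show ?thesis using big[of "r k"] by linarith
  qed
  ultimately have "\<epsilon> / 2 \<le> 0" by (intro LIMSEQ_le_const) auto
  then show False using \<epsilon> by simp
qed

lemma pairing_tendsto_0_uniformly:
  fixes w :: "nat \<Rightarrow> 'a \<Rightarrow> ('e::{banach, second_countable_topology} \<Rightarrow>\<^sub>L real)"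
  assumes K: "compactin (weak_L1_topology M) K" and \<epsilon>: "\<epsilon> > 0"
    and w: "\<And>n. w n \<in> Linf_dual_space M" "\<And>n. AE \<omega> in M. norm (w n \<omega>) \<le> C"
    and lim: "AE \<omega> in M. (\<lambda>n. norm (w n \<omega>)) \<longlonglongrightarrow> 0"
  shows "\<forall>\<^sub>F n in sequentially. \<forall>x\<in>K. \<bar>pairing M (w n) x\<bar> < \<epsilon>"
proof (rule ccontr)
  assume "\<not> (\<forall>\<^sub>F n in sequentially. \<forall>x\<in>K. \<bar>pairing M (w n) x\<bar> < \<epsilon>)"
  then have "infinite {n. \<exists>x\<in>K. \<epsilon> \<le> \<bar>pairing M (w n) x\<bar>}"
    unfolding eventually_sequentially infinite_nat_iff_unbounded_le mem_Collect_eq by (meson not_less)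
  from infinite_enumerate[OF this] obtain r :: "nat \<Rightarrow> nat"
    where r: "strict_mono r" "\<And>n. \<exists>x\<in>K. \<epsilon> \<le> \<bar>pairing M (w (r n)) x\<bar>" by blast
  from r(2) have "\<forall>n. \<exists>x. x \<in> K \<and> \<epsilon> \<le> \<bar>pairing M (w (r n)) x\<bar>" by blast
  then have "\<exists>h. \<forall>n. h n \<in> K \<and> \<epsilon> \<le> \<bar>pairing M (w (r n)) (h n)\<bar>" by (rule choice)
  then obtain h where h: "\<And>n. h n \<in> K" "\<And>n. \<epsilon> \<le> \<bar>pairing M (w (r n)) (h n)\<bar>" by blast
  \<comment> \<open>The pointwise bound is needed everywhere; cutting \<open>w\<close> off on a null set does not change pairings.\<close>
  define w' where "w' n \<omega> = (if norm (w (r n) \<omega>) \<le> C then w (r n) \<omega> else 0)" for n \<omega>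
  define C' where "C' = max C 0"
  have sm: "scalarly_measurable M (w n)" for n by (rule Linf_dual_space_scalarly_measurable[OF w(1)])
  have w'_meas: "scalarly_measurable M (w' n)" for n
    unfolding w'_def[abs_def]
  proof (rule scalarly_measurable_If[OF _ sm])
    show "Measurable.pred M (\<lambda>\<omega>. norm (w (r n) \<omega>) \<le> C)"
      using scalarly_measurable_norm[OF sm] by simp
  qed (simp add: scalarly_measurable_def blinfun.zero_left)
  have eq: "pairing M (w' n) (h n) = pairing M (w (r n)) (h n)" for n
    unfolding pairing_def
  proof (rule integral_cong_AE)
    note int = weakly_compact_subset_L1[OF K h(1), THEN borel_measurable_integrable]
    show "(\<lambda>\<omega>. w' n \<omega> (h n \<omega>)) \<in> borel_measurable M" "(\<lambda>\<omega>. w (r n) \<omega> (h n \<omega>)) \<in> borel_measurable M"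
      by (rule scalarly_measurable_pairing[OF w'_meas int], rule scalarly_measurable_pairing[OF sm int])
    show "AE \<omega> in M. w' n \<omega> (h n \<omega>) = w (r n) \<omega> (h n \<omega>)"
      using w(2)[of "r n"] by eventually_elim (simp add: w'_def)
  qed
  have "\<exists>n. \<bar>pairing M (w' n) (h n)\<bar> < \<epsilon>"
  proof (rule bounded_null_sequence_pairing_small[OF K h(1) \<epsilon> w'_meas, where C = C'])
    show "norm (w' n \<omega>) \<le> C'" for n \<omega> by (simp add: w'_def C'_def le_max_iff_disj)
    show "AE \<omega> in M. (\<lambda>n. norm (w' n \<omega>)) \<longlonglongrightarrow> 0"
      using lim
    proof eventually_elim
      fix \<omega> assume "(\<lambda>n. norm (w n \<omega>)) \<longlonglongrightarrow> 0"
      from LIMSEQ_subseq_LIMSEQ[OF this r(1)] have "(\<lambda>n. norm (w (r n) \<omega>)) \<longlonglongrightarrow> 0" by (simp add: comp_def)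
      then show "(\<lambda>n. norm (w' n \<omega>)) \<longlonglongrightarrow> 0"
        by (rule Lim_null_comparison[rotated]) (simp add: w'_def)
    qed
  qed
  with h(2) show False unfolding eq by (meson not_less)
qed

text \<open>Weakly compact sets are bounded, for the norm of \<open>L\<^sub>1\<close> that is seen by \<open>L\<^sub>\<infinity>\<close>; otherwise a sequence \<open>w n\<close>
of norm at most \<open>1 / (n + 1)\<close> would contradict the previous lemma.\<close>

lemma pairing_uniformly_small:
  assumes K: "compactin (weak_L1_topology M) K" and \<epsilon>: "\<epsilon> > 0"
  obtains \<delta> where "\<delta> > 0" "\<And>w x. w \<in> Linf_dual_space M \<Longrightarrow> (AE \<omega> in M. norm (w \<omega>) \<le> \<delta>) \<Longrightarrow>
    x \<in> K \<Longrightarrow> \<bar>pairing M w x\<bar> < \<epsilon>"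
proof (rule ccontr)
  assume "\<not> thesis"
  then have "\<forall>\<delta>>0. \<exists>w. w \<in> Linf_dual_space M \<and> (AE \<omega> in M. norm (w \<omega>) \<le> \<delta>) \<and>
      \<not> (\<forall>x\<in>K. \<bar>pairing M w x\<bar> < \<epsilon>)"
    using that by blast
  then have "\<forall>n. \<exists>w. w \<in> Linf_dual_space M \<and> (AE \<omega> in M. norm (w \<omega>) \<le> inverse (real (Suc n))) \<and>
      \<not> (\<forall>x\<in>K. \<bar>pairing M w x\<bar> < \<epsilon>)" by simp
  from choice[OF this] obtain w where w: "\<And>n. w n \<in> Linf_dual_space M"
    "\<And>n. AE \<omega> in M. norm (w n \<omega>) \<le> inverse (real (Suc n))"
    "\<And>n. \<not> (\<forall>x\<in>K. \<bar>pairing M (w n) x\<bar> < \<epsilon>)" by blast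
  have "\<forall>\<^sub>F n in sequentially. \<forall>x\<in>K. \<bar>pairing M (w n) x\<bar> < \<epsilon>"
  proof (rule pairing_tendsto_0_uniformly[OF K \<epsilon> w(1), where C = 1])
    show "AE \<omega> in M. norm (w n \<omega>) \<le> 1" for n
      using w(2)[of n] by eventually_elim (erule order_trans, simp add: inverse_le_1_iff del: of_nat_Suc)
    have "AE \<omega> in M. \<forall>n. norm (w n \<omega>) \<le> inverse (real (Suc n))"
      using w(2) by (simp add: AE_all_countable)
    then show "AE \<omega> in M. (\<lambda>n. norm (w n \<omega>)) \<longlonglongrightarrow> 0"
      by eventually_elim (rule tendsto_sandwich[OF _ _ tendsto_const LIMSEQ_inverse_real_of_nat], auto)
  qed
  then show False using w(3) by (auto simp: eventually_sequentially)
qed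

section \<open>Convergence in the Mackey topology and the epi-limit inequality\<close>

text \<open>The difference \<open>z n - x\<close> is split into its part on \<open>W n\<close>, which is small in norm, and its part off
\<open>W n\<close>, which is bounded and tends to \<open>0\<close> almost everywhere. The radius \<open>\<delta>\<close> depends on \<open>V\<close> and \<open>x\<close> only,
so that \<open>z\<close> may be constructed after \<open>\<delta>\<close> is known.\<close>

lemma mackey_eventually_mem:
  assumes V: "openin (mackey_topology M) V" "x \<in> V"
  obtains \<delta> where "\<delta> > 0" "\<And>z W C. (\<And>n. z n \<in> Linf_dual_space M) \<Longrightarrow>
      (\<And>n. AE \<omega> in M. norm (z n \<omega>) \<le> C) \<Longrightarrow> (\<And>n::nat. W n \<in> sets M) \<Longrightarrow>
      (\<And>n. AE \<omega> in M. \<omega> \<in> W n \<longrightarrow> norm (z n \<omega> - x \<omega>) \<le> \<delta>) \<Longrightarrow>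
      (AE \<omega> in M. \<forall>\<^sub>F n in sequentially. \<omega> \<in> W n) \<Longrightarrow> \<forall>\<^sub>F n in sequentially. z n \<in> V"
proof -
  let ?\<S> = "{K. compactin (weak_L1_topology M) K \<and> fun_convex K}"
  have V': "V \<subseteq> Linf_dual_space M" "\<forall>y\<in>V. \<exists>\<K> \<epsilon>. finite \<K> \<and> \<K> \<subseteq> ?\<S> \<and> \<epsilon> > 0 \<and>
      {z \<in> Linf_dual_space M. \<forall>K\<in>\<K>. \<forall>h\<in>K. \<bar>pairing M z h - pairing M y h\<bar> < \<epsilon>} \<subseteq> V"
    using V(1) unfolding mackey_topology_def openin_uniform_conv_topology by (rule conjunct1, rule conjunct2)
  from bspec[OF V'(2) V(2)] obtain \<K> \<epsilon> where \<K>0: "finite \<K>" "\<K> \<subseteq> ?\<S>" "\<epsilon> > 0"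
      "{z \<in> Linf_dual_space M. \<forall>K\<in>\<K>. \<forall>h\<in>K. \<bar>pairing M z h - pairing M x h\<bar> < \<epsilon>} \<subseteq> V"
    by (elim exE conjE)
  have \<K>: "finite \<K>" "\<And>K. K \<in> \<K> \<Longrightarrow> compactin (weak_L1_topology M) K" "\<epsilon> > 0"
    using \<K>0(1-3) by auto
  have sub: "z \<in> V" if "z \<in> Linf_dual_space M"
      "\<forall>K\<in>\<K>. \<forall>h\<in>K. \<bar>pairing M z h - pairing M x h\<bar> < \<epsilon>" for z
    by (rule subsetD[OF \<K>0(4)]) (use that in simp)
  have xL: "x \<in> Linf_dual_space M" by (rule subsetD[OF V'(1) V(2)])
  then obtain C0 where C0: "AE \<omega> in M. norm (x \<omega>) \<le> C0" by (auto simp: Linf_dual_space_def)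
  have "\<forall>K\<in>\<K>. \<exists>\<delta>. \<delta> > 0 \<and> (\<forall>w h. w \<in> Linf_dual_space M \<longrightarrow> (AE \<omega> in M. norm (w \<omega>) \<le> \<delta>) \<longrightarrow>
      h \<in> K \<longrightarrow> \<bar>pairing M w h\<bar> < \<epsilon> / 2)"
  proof
    fix K assume "K \<in> \<K>"
    from pairing_uniformly_small[OF \<K>(2)[OF this], of "\<epsilon> / 2"] \<K>(3)
    show "\<exists>\<delta>. \<delta> > 0 \<and> (\<forall>w h. w \<in> Linf_dual_space M \<longrightarrow> (AE \<omega> in M. norm (w \<omega>) \<le> \<delta>) \<longrightarrow>
      h \<in> K \<longrightarrow> \<bar>pairing M w h\<bar> < \<epsilon> / 2)" by (metis half_gt_zero)
  qed
  from bchoice[OF this] obtain \<delta>K where \<delta>K: "\<And>K. K \<in> \<K> \<Longrightarrow> \<delta>K K > 0"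
    "\<And>K w h. K \<in> \<K> \<Longrightarrow> w \<in> Linf_dual_space M \<Longrightarrow> (AE \<omega> in M. norm (w \<omega>) \<le> \<delta>K K) \<Longrightarrow>
      h \<in> K \<Longrightarrow> \<bar>pairing M w h\<bar> < \<epsilon> / 2" by blast
  define \<delta> where "\<delta> = Min (insert 1 (\<delta>K ` \<K>))"
  have \<delta>: "\<delta> > 0" "\<And>K. K \<in> \<K> \<Longrightarrow> \<delta> \<le> \<delta>K K"
    unfolding \<delta>_def using \<K>(1) \<delta>K(1) by auto
  show thesis
  proof (rule that[OF \<delta>(1)])
    fix z :: "nat \<Rightarrow> 'a \<Rightarrow> ('b \<Rightarrow>\<^sub>L real)" and W :: "nat \<Rightarrow> 'a set" and C
    assume z: "\<And>n. z n \<in> Linf_dual_space M" "\<And>n. AE \<omega> in M. norm (z n \<omega>) \<le> C"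
      and W: "\<And>n. W n \<in> sets M" "\<And>n. AE \<omega> in M. \<omega> \<in> W n \<longrightarrow> norm (z n \<omega> - x \<omega>) \<le> \<delta>"
        "AE \<omega> in M. \<forall>\<^sub>F n in sequentially. \<omega> \<in> W n"
    define d where "d n \<omega> = z n \<omega> - x \<omega>" for n \<omega>
    define v where "v n \<omega> = (if \<omega> \<in> W n then d n \<omega> else 0)" for n \<omega>
    define u where "u n \<omega> = (if \<omega> \<in> W n then 0 else d n \<omega>)" for n \<omega>
    have sm: "scalarly_measurable M (d n)" "scalarly_measurable M (\<lambda>_. 0 :: 'b \<Rightarrow>\<^sub>L real)" for n
      unfolding d_def[abs_def]
      by (intro scalarly_measurable_diff Linf_dual_space_scalarly_measurable z(1) xL)
         (simp add: scalarly_measurable_def blinfun.zero_left)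
    have pred: "Measurable.pred M (\<lambda>\<omega>. \<omega> \<in> W n)" for n using W(1) by simp
    have v_le: "AE \<omega> in M. norm (v n \<omega>) \<le> \<delta>" for n
      using W(2)[of n] \<delta>(1) by (auto simp: v_def d_def elim: eventually_mono)
    have u_le: "AE \<omega> in M. norm (u n \<omega>) \<le> \<bar>C\<bar> + \<bar>C0\<bar>" for n
      using z(2)[of n] C0
    proof eventually_elim
      fix \<omega> assume "norm (z n \<omega>) \<le> C" "norm (x \<omega>) \<le> C0"
      then show "norm (u n \<omega>) \<le> \<bar>C\<bar> + \<bar>C0\<bar>"
        using norm_triangle_ineq4[of "z n \<omega>" "x \<omega>"] unfolding u_def d_def by auto
    qed
    have vL: "v n \<in> Linf_dual_space M" for n
      unfolding v_def[abs_def]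
      by (rule Linf_dual_spaceI[OF scalarly_measurable_If[OF pred sm]]) (rule v_le[unfolded v_def])
    have uL: "u n \<in> Linf_dual_space M" for n
      unfolding u_def[abs_def]
      by (rule Linf_dual_spaceI[OF scalarly_measurable_If[OF pred sm(2,1)]]) (rule u_le[unfolded u_def])
    have u_lim: "AE \<omega> in M. (\<lambda>n. norm (u n \<omega>)) \<longlonglongrightarrow> 0"
      using W(3)
    proof eventually_elim
      fix \<omega> assume "\<forall>\<^sub>F n in sequentially. \<omega> \<in> W n"
      then have "\<forall>\<^sub>F n in sequentially. norm (u n \<omega>) = 0" by (auto simp: u_def elim: eventually_mono)
      then show "(\<lambda>n. norm (u n \<omega>)) \<longlonglongrightarrow> 0" by (rule tendsto_eventually)
    qed
    have "\<forall>\<^sub>F n in sequentially. \<forall>h\<in>K. \<bar>pairing M (u n) h\<bar> < \<epsilon> / 2" if "K \<in> \<K>" for K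
      using \<K>(3) by (intro pairing_tendsto_0_uniformly[OF \<K>(2)[OF that] _ uL u_le u_lim]) simp
    then have "\<forall>\<^sub>F n in sequentially. \<forall>K\<in>\<K>. \<forall>h\<in>K. \<bar>pairing M (u n) h\<bar> < \<epsilon> / 2"
      using \<K>(1) by (simp add: eventually_ball_finite_distrib)
    then show "\<forall>\<^sub>F n in sequentially. z n \<in> V"
    proof eventually_elim
      fix n assume n: "\<forall>K\<in>\<K>. \<forall>h\<in>K. \<bar>pairing M (u n) h\<bar> < \<epsilon> / 2"
      show "z n \<in> V"
      proof (rule sub[OF z(1)], intro ballI)
        fix K h assume K: "K \<in> \<K>" "h \<in> K"
        have int: "integrable M h" by (rule weakly_compact_subset_L1[OF \<K>(2)[OF K(1)] K(2)])
        have "pairing M (d n) h = (\<integral>\<omega>. v n \<omega> (h \<omega>) + u n \<omega> (h \<omega>) \<partial>M)"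
          unfolding pairing_def by (intro Bochner_Integration.integral_cong refl) (simp add: u_def v_def blinfun.zero_left)
        also have "\<dots> = pairing M (v n) h + pairing M (u n) h"
          unfolding pairing_def by (intro Bochner_Integration.integral_add integrable_pairing vL uL int)
        finally have "pairing M (d n) h = pairing M (v n) h + pairing M (u n) h" .
        moreover have "pairing M (d n) h = pairing M (z n) h - pairing M x h"
          unfolding d_def[abs_def] by (rule pairing_diff[OF z(1) xL int])
        moreover have "\<bar>pairing M (v n) h\<bar> < \<epsilon> / 2"
          using v_le[of n] \<delta>(2)[OF K(1)]
          by (intro \<delta>K(2)[OF K(1) vL _ K(2)]) (auto elim: eventually_mono)
        moreover have "\<bar>pairing M (u n) h\<bar> < \<epsilon> / 2" using n K by blast
        ultimately show "\<bar>pairing M (z n) h - pairing M x h\<bar> < \<epsilon>" by linarith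
      qed
    qed
  qed
qed

lemma epi_limsup_eventually_near:
  fixes g :: "nat \<Rightarrow> 'y::metric_space \<Rightarrow> ereal"
  assumes "epi_limsup euclidean g y < c" "\<delta> > 0"
  shows "\<forall>\<^sub>F n in sequentially. \<exists>z. dist y z < \<delta> \<and> g n z < c"
proof -
  have "limsup (\<lambda>n. INF z\<in>ball y \<delta>. g n z) \<le> epi_limsup euclidean g y"
    unfolding epi_limsup_def using \<open>\<delta> > 0\<close> by (intro SUP_upper) simp
  then have "limsup (\<lambda>n. INF z\<in>ball y \<delta>. g n z) < c" using assms(1) by (rule le_less_trans)
  then have "\<forall>\<^sub>F n in sequentially. (INF z\<in>ball y \<delta>. g n z) < c" by (rule Limsup_lessD)
  then show ?thesis by eventually_elim (auto simp: INF_less_iff)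
qed

lemma upper_integral_le:
  assumes "integrable M u" "AE \<omega> in M. v \<omega> \<le> ereal (u \<omega>)"
  shows "upper_integral M v \<le> ereal (\<integral>\<omega>. u \<omega> \<partial>M)"
  unfolding upper_integral_def using assms by (intro INF_lower) simp

text \<open>The strict inequality for the epi-limit leaves room to choose nearly optimal points measurably;
\<open>x0\<close> is the fallback on the exceptional sets, where \<open>u0\<close> bounds the integrands.\<close>

lemma limsup_INF_integral_functional_le:
  fixes M :: "'a measure"
    and fn :: "nat \<Rightarrow> 'a \<Rightarrow> ('e::{banach, second_countable_topology} \<Rightarrow>\<^sub>L real) \<Rightarrow> ereal"
  assumes M: "sigma_finite_measure M"
    and fn: "\<And>n. (\<lambda>(\<omega>, y). fn n \<omega> y) \<in> borel_measurable (M \<Otimes>\<^sub>M weak_star_borel)"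
    and x0: "x0 \<in> Linf_dual_space M" and u0: "integrable M u0"
    and dom: "\<And>n. AE \<omega> in M. fn n \<omega> (x0 \<omega>) \<le> ereal (u0 \<omega>)"
    and V: "openin (mackey_topology M) V" "x \<in> V"
    and v: "integrable M v" "AE \<omega> in M. epi_limsup euclidean (\<lambda>n. fn n \<omega>) (x \<omega>) < ereal (v \<omega>)"
  shows "limsup (\<lambda>n. INF z\<in>V. integral_functional M (fn n) z) \<le> ereal (\<integral>\<omega>. v \<omega> \<partial>M)"
proof -
  obtain \<delta> where \<delta>: "\<delta> > 0" and ev: "\<And>z W C. (\<And>n. z n \<in> Linf_dual_space M) \<Longrightarrow>
      (\<And>n. AE \<omega> in M. norm (z n \<omega>) \<le> C) \<Longrightarrow> (\<And>n::nat. W n \<in> sets M) \<Longrightarrow>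
      (\<And>n. AE \<omega> in M. \<omega> \<in> W n \<longrightarrow> norm (z n \<omega> - x \<omega>) \<le> \<delta>) \<Longrightarrow>
      (AE \<omega> in M. \<forall>\<^sub>F n in sequentially. \<omega> \<in> W n) \<Longrightarrow> \<forall>\<^sub>F n in sequentially. z n \<in> V"
    by (rule mackey_eventually_mem[OF V]) blast
  have xL: "x \<in> Linf_dual_space M"
    using V unfolding mackey_topology_def openin_uniform_conv_topology by blast
  obtain C where C: "AE \<omega> in M. norm (x \<omega>) \<le> C" using xL by (auto simp: Linf_dual_space_def)
  obtain C0 where C0: "AE \<omega> in M. norm (x0 \<omega>) \<le> C0" using x0 by (auto simp: Linf_dual_space_def)
  let ?P = "M \<Otimes>\<^sub>M (weak_star_borel :: ('e \<Rightarrow>\<^sub>L real) measure)"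
  define G where "G n = {p \<in> space ?P. norm (snd p - x (fst p)) < \<delta> \<and>
    fn n (fst p) (snd p) < ereal (v (fst p))}" for n
  have G: "G n \<in> sets ?P" for n
  proof -
    have "scalarly_measurable ?P (\<lambda>p. snd p)" "scalarly_measurable ?P (\<lambda>p. x (fst p))"
      using measurable_compose[OF measurable_snd] measurable_compose[OF measurable_fst]
        scalarly_measurable_weak_star_borel_ident Linf_dual_space_scalarly_measurable[OF xL]
      unfolding scalarly_measurable_def by blast+
    then have 1: "(\<lambda>p. norm (snd p - x (fst p))) \<in> borel_measurable ?P"
      by (intro scalarly_measurable_norm scalarly_measurable_diff)
    have 2: "(\<lambda>p. fn n (fst p) (snd p)) \<in> borel_measurable ?P"
      using fn[of n] by (simp add: case_prod_unfold)
    have 3: "(\<lambda>p. ereal (v (fst p))) \<in> borel_measurable ?P"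
      using v(1) by (intro borel_measurable_ereal measurable_compose[OF measurable_fst]) auto
    show ?thesis
      unfolding G_def by (intro sets.sets_Collect_conj borel_measurable_less 1 2 3 borel_measurable_const)
  qed
  have "\<exists>W y. W \<in> sets M \<and> scalarly_measurable M y \<and> (\<forall>\<omega>\<in>W. (\<omega>, y \<omega>) \<in> G n) \<and>
      (AE \<omega> in M. (\<exists>y. (\<omega>, y) \<in> G n) \<longrightarrow> \<omega> \<in> W)" for n
    by (rule measurable_selection_dual[OF M G[of n]]) blast
  then have "\<forall>n. \<exists>W y. W \<in> sets M \<and> scalarly_measurable M y \<and> (\<forall>\<omega>\<in>W. (\<omega>, y \<omega>) \<in> G n) \<and>
      (AE \<omega> in M. (\<exists>y. (\<omega>, y) \<in> G n) \<longrightarrow> \<omega> \<in> W)" ..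
  from choice[OF this] obtain W where "\<forall>n. \<exists>y. W n \<in> sets M \<and> scalarly_measurable M y \<and>
      (\<forall>\<omega>\<in>W n. (\<omega>, y \<omega>) \<in> G n) \<and> (AE \<omega> in M. (\<exists>y. (\<omega>, y) \<in> G n) \<longrightarrow> \<omega> \<in> W n)" by (rule exE)
  from choice[OF this] obtain y where Wy: "\<forall>n. W n \<in> sets M \<and> scalarly_measurable M (y n) \<and>
      (\<forall>\<omega>\<in>W n. (\<omega>, y n \<omega>) \<in> G n) \<and> (AE \<omega> in M. (\<exists>y. (\<omega>, y) \<in> G n) \<longrightarrow> \<omega> \<in> W n)" by (rule exE)
  have W: "W n \<in> sets M" and y: "scalarly_measurable M (y n)"
    and sel: "\<And>\<omega>. \<omega> \<in> W n \<Longrightarrow> (\<omega>, y n \<omega>) \<in> G n"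
    and full: "AE \<omega> in M. (\<exists>y. (\<omega>, y) \<in> G n) \<longrightarrow> \<omega> \<in> W n" for n
    using Wy[rule_format, of n] by blast+
  have sel_near: "norm (y n \<omega> - x \<omega>) < \<delta>" and sel_less: "fn n \<omega> (y n \<omega>) < ereal (v \<omega>)"
    if "\<omega> \<in> W n" for n \<omega>
    using sel[OF that] by (simp_all add: G_def)
  define z where "z n \<omega> = (if \<omega> \<in> W n then y n \<omega> else x0 \<omega>)" for n \<omega>
  have z_le: "AE \<omega> in M. norm (z n \<omega>) \<le> \<bar>C\<bar> + \<delta> + \<bar>C0\<bar>" for n
    using C C0
  proof eventually_elim
    fix \<omega> assume "norm (x \<omega>) \<le> C" "norm (x0 \<omega>) \<le> C0"
    then show "norm (z n \<omega>) \<le> \<bar>C\<bar> + \<delta> + \<bar>C0\<bar>"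
      using \<delta> sel_near[of \<omega> n] norm_triangle_sub[of "y n \<omega>" "x \<omega>"] by (auto simp: z_def)
  qed
  have z_L: "z n \<in> Linf_dual_space M" for n
  proof (rule Linf_dual_spaceI[OF _ z_le])
    show "scalarly_measurable M (z n)"
      unfolding z_def[abs_def] using W y Linf_dual_space_scalarly_measurable[OF x0]
      by (intro scalarly_measurable_If) auto
  qed
  have W_ev: "AE \<omega> in M. \<forall>\<^sub>F n in sequentially. \<omega> \<in> W n"
  proof -
    have "AE \<omega> in M. \<forall>n. (\<exists>y. (\<omega>, y) \<in> G n) \<longrightarrow> \<omega> \<in> W n" using full by (simp add: AE_all_countable)
    with v(2) AE_space show ?thesis
    proof eventually_elim
      fix \<omega> assume \<omega>: "epi_limsup euclidean (\<lambda>n. fn n \<omega>) (x \<omega>) < ereal (v \<omega>)"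
        "\<omega> \<in> space M" "\<forall>n. (\<exists>y. (\<omega>, y) \<in> G n) \<longrightarrow> \<omega> \<in> W n"
      from epi_limsup_eventually_near[OF \<omega>(1) \<delta>]
      show "\<forall>\<^sub>F n in sequentially. \<omega> \<in> W n"
      proof eventually_elim
        fix n assume "\<exists>z. dist (x \<omega>) z < \<delta> \<and> fn n \<omega> z < ereal (v \<omega>)"
        then obtain z where "dist (x \<omega>) z < \<delta>" "fn n \<omega> z < ereal (v \<omega>)" by blast
        then have "(\<omega>, z) \<in> G n"
          using \<omega>(2) by (simp add: G_def space_pair_measure dist_norm norm_minus_commute)
        then show "\<omega> \<in> W n" using \<omega>(3) by blast
      qed
    qed
  qed
  have near: "AE \<omega> in M. \<omega> \<in> W n \<longrightarrow> norm (z n \<omega> - x \<omega>) \<le> \<delta>" for n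
    by (rule AE_I2) (auto simp: z_def intro: less_imp_le[OF sel_near])
  have z_V: "\<forall>\<^sub>F n in sequentially. z n \<in> V"
    by (rule ev[OF z_L z_le W near W_ev])
  define b where "b n \<omega> = (if \<omega> \<in> W n then v \<omega> else u0 \<omega>)" for n \<omega>
  have b_meas: "b n \<in> borel_measurable M" for n
    unfolding b_def[abs_def] using v(1) u0 W[of n] by (intro measurable_If) auto
  have b_bound: "AE \<omega> in M. norm (b n \<omega>) \<le> \<bar>v \<omega>\<bar> + \<bar>u0 \<omega>\<bar>" for n
    by (rule AE_I2) (simp add: b_def)
  have b_int: "integrable M (b n)" for n
    by (rule Bochner_Integration.integrable_bound[of M "\<lambda>\<omega>. \<bar>v \<omega>\<bar> + \<bar>u0 \<omega>\<bar>"])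
       (use v(1) u0 b_meas in \<open>auto simp: b_def\<close>)
  have "integral_functional M (fn n) (z n) \<le> ereal (\<integral>\<omega>. b n \<omega> \<partial>M)" for n
    unfolding integral_functional_def
  proof (rule upper_integral_le[OF b_int])
    show "AE \<omega> in M. fn n \<omega> (z n \<omega>) \<le> ereal (b n \<omega>)"
      using dom[of n] by eventually_elim (auto simp: z_def b_def intro: less_imp_le[OF sel_less])
  qed
  then have "\<forall>\<^sub>F n in sequentially. (INF z\<in>V. integral_functional M (fn n) z) \<le> ereal (\<integral>\<omega>. b n \<omega> \<partial>M)"
    using z_V by (auto elim!: eventually_mono intro: INF_lower2)
  then have "limsup (\<lambda>n. INF z\<in>V. integral_functional M (fn n) z) \<le> limsup (\<lambda>n. ereal (\<integral>\<omega>. b n \<omega> \<partial>M))"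
    by (rule Limsup_mono)
  also have "\<dots> = ereal (\<integral>\<omega>. v \<omega> \<partial>M)"
  proof (rule lim_imp_Limsup)
    have "(\<lambda>n. \<integral>\<omega>. b n \<omega> \<partial>M) \<longlonglongrightarrow> (\<integral>\<omega>. v \<omega> \<partial>M)"
    proof (rule integral_dominated_convergence[of _ _ _ "\<lambda>\<omega>. \<bar>v \<omega>\<bar> + \<bar>u0 \<omega>\<bar>"])
      show "AE \<omega> in M. (\<lambda>n. b n \<omega>) \<longlonglongrightarrow> v \<omega>"
        using W_ev by eventually_elim (rule tendsto_eventually, erule eventually_mono, simp add: b_def)
    qed (use v(1) u0 b_meas b_bound in auto)
    then show "(\<lambda>n. ereal (\<integral>\<omega>. b n \<omega> \<partial>M)) \<longlonglongrightarrow> ereal (\<integral>\<omega>. v \<omega> \<partial>M)" by simp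
  qed simp
  finally show ?thesis .
qed

theorem proposition5p3:
  fixes M :: "'a measure"
    and fn :: "nat \<Rightarrow> 'a \<Rightarrow> ('e::{banach, second_countable_topology} \<Rightarrow>\<^sub>L real) \<Rightarrow> ereal"
    and f :: "'a \<Rightarrow> ('e \<Rightarrow>\<^sub>L real) \<Rightarrow> ereal"
    and x0 :: "'a \<Rightarrow> ('e \<Rightarrow>\<^sub>L real)"
    and u0 :: "'a \<Rightarrow> real"
  assumes "sigma_finite_measure M" and "complete_measure M"
    and "\<And>n. (\<lambda>(\<omega>, y). fn n \<omega> y) \<in> borel_measurable (M \<Otimes>\<^sub>M weak_star_borel)"
    and "x0 \<in> Linf_dual_space M" and "integrable M u0"
    and "\<And>n. AE \<omega> in M. fn n \<omega> (x0 \<omega>) \<le> ereal (u0 \<omega>)"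
    and "\<And>\<omega>. \<omega> \<in> space M \<Longrightarrow> f \<omega> = epi_limsup euclidean (\<lambda>n. fn n \<omega>)"
  shows "\<forall>x\<in>Linf_dual_space M.
           epi_limsup (mackey_topology M) (\<lambda>n. integral_functional M (fn n)) x
             \<le> integral_functional M f x"
proof (rule ballI)
  fix x :: "'a \<Rightarrow> ('e \<Rightarrow>\<^sub>L real)"
  interpret sigma_finite_measure M by fact
  obtain h :: "'a \<Rightarrow> real" where h: "\<And>\<omega>. h \<omega> > 0" "integrable M h"
    by (rule obtain_positive_integrable_function) blast
  have h_nn: "0 \<le> (\<integral>\<omega>. h \<omega> \<partial>M)" by (intro integral_nonneg_AE AE_I2 less_imp_le h)
  show "epi_limsup (mackey_topology M) (\<lambda>n. integral_functional M (fn n)) x \<le> integral_functional M f x"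
    unfolding epi_limsup_def[of "mackey_topology M"] integral_functional_def[of M f] upper_integral_def
  proof (intro SUP_least INF_greatest, rule ereal_le_epsilon2)
    fix V u and \<epsilon> :: real
    assume "V \<in> {V. openin (mackey_topology M) V \<and> x \<in> V}"
      and "u \<in> {u :: 'a \<Rightarrow> real. integrable M u \<and> (AE \<omega> in M. f \<omega> (x \<omega>) \<le> ereal (u \<omega>))}"
      and \<epsilon>: "0 < \<epsilon>"
    then have V: "openin (mackey_topology M) V" "x \<in> V"
      and u: "integrable M u" "AE \<omega> in M. f \<omega> (x \<omega>) \<le> ereal (u \<omega>)" by auto
    \<comment> \<open>\<open>h\<close> turns the strict pointwise inequality into an error of at most \<open>\<epsilon>\<close> in the integral, even
      when \<open>M\<close> is infinite.\<close>
    define c where "c = \<epsilon> / ((\<integral>\<omega>. h \<omega> \<partial>M) + 1)"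
    have c: "c > 0" "c * ((\<integral>\<omega>. h \<omega> \<partial>M) + 1) = \<epsilon>"
      using \<epsilon> h_nn by (simp_all add: c_def)
    then have c_le: "c * (\<integral>\<omega>. h \<omega> \<partial>M) \<le> \<epsilon>" by (simp add: distrib_left)
    have "AE \<omega> in M. epi_limsup euclidean (\<lambda>n. fn n \<omega>) (x \<omega>) < ereal (u \<omega> + c * h \<omega>)"
      using u(2) AE_space
    proof eventually_elim
      fix \<omega> assume "f \<omega> (x \<omega>) \<le> ereal (u \<omega>)" "\<omega> \<in> space M"
      then have "epi_limsup euclidean (\<lambda>n. fn n \<omega>) (x \<omega>) \<le> ereal (u \<omega>)"
        using assms(7)[of \<omega>] by simp
      also have "ereal (u \<omega>) < ereal (u \<omega> + c * h \<omega>)" using c(1) h(1) by simp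
      finally show "epi_limsup euclidean (\<lambda>n. fn n \<omega>) (x \<omega>) < ereal (u \<omega> + c * h \<omega>)" .
    qed
    then have "limsup (\<lambda>n. INF z\<in>V. integral_functional M (fn n) z) \<le> ereal (\<integral>\<omega>. u \<omega> + c * h \<omega> \<partial>M)"
      using u(1) h(2) by (intro limsup_INF_integral_functional_le[OF assms(1,3,4,5,6) V]) auto
    also have "\<dots> = ereal ((\<integral>\<omega>. u \<omega> \<partial>M) + c * (\<integral>\<omega>. h \<omega> \<partial>M))"
      using u(1) h(2) by simp
    also have "\<dots> \<le> ereal (\<integral>\<omega>. u \<omega> \<partial>M) + ereal \<epsilon>" using c_le by simp
    finally show "limsup (\<lambda>n. INF z\<in>V. integral_functional M (fn n) z) \<le> ereal (\<integral>\<omega>. u \<omega> \<partial>M) + ereal \<epsilon>" .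
  qed
qed

end
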